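(* Let $n\ge1$, $N\ge2$, and let $\phi$ be a strictly local communication kernel of range $r_0>0$ on $\mathbb{T}^n$ (as defined in the context). For an initial datum $(\mathbf{x}_0,\mathbf{v}_0)\in\mathbb{T}^{nN}\times\mathbb{R}^{nN}$ let $(\mathbf{x}(t),\mathbf{v}(t))$ be the solution of $$\dot x_i=v_i,\qquad \dot v_i=\frac1N\sum_{j=1}^N\phi(x_i-x_j)(v_j-v_i),\qquad i=1,\dots,N,$$ and put $\phi_{ij}(s,\mathbf{x}_0,\mathbf{v}_0)=\phi(x_i(s)-x_j(s))$. Then $$\int_0^\infty\sum_{i\neq j}\phi_{ij}(s,\mathbf{x}_0,\mathbf{v}_0)\,ds=\infty$$ for Lebesgue-almost every $(\mathbf{x}_0,\mathbf{v}_0)\in\mathbb{T}^{nN}\times\mathbb{R}^{nN}$.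
   Context: $\mathbb{T}^n=\mathbb{R}^n/2\pi\mathbb{Z}^n$. $\mathbf{x}=(x_1,\dots,x_N)$ with $x_i\in\mathbb{T}^n$, $\mathbf{v}=(v_1,\dots,v_N)$ with $v_i\in\mathbb{R}^n$. For $x\in\mathbb{T}^n$, $|x|$ denotes the flat (geodesic) distance from $x$ to $0$. A strictly local communication kernel of range $r_0>0$ on $\mathbb{T}^n$ is a $C^1$ function $\phi:\mathbb{T}^n\to[0,\infty)$ that is a non-increasing function of $|x|$ and is supported on the ball of radius $r_0$: $\phi(x)>0$ for $|x|<r_0$ and $\phi(x)=0$ for $|x|\ge r_0$. *)

theory Defs
  imports "HOL-Analysis.Analysis"
begin

section \<open>The torus \<open>\<real>\<^sup>n / 2\<pi>\<int>\<^sup>n\<close>\<close>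

definition torus_rel :: "real ^ 'n \<Rightarrow> real ^ 'n \<Rightarrow> bool" where
  "torus_rel x y \<longleftrightarrow> (\<forall>i. \<exists>k::int. x $ i - y $ i = 2 * pi * of_int k)"

lemma torus_rel_refl: "torus_rel x x"
  unfolding torus_rel_def by (auto intro: exI[of _ 0])

lemma torus_rel_sym:
  assumes "torus_rel x y"
  shows "torus_rel y x"
  unfolding torus_rel_def
proof
  fix i
  obtain k :: int where "x $ i - y $ i = 2 * pi * of_int k"
    using assms unfolding torus_rel_def by blast
  then have "y $ i - x $ i = 2 * pi * of_int (- k)" by simp
  then show "\<exists>k::int. y $ i - x $ i = 2 * pi * of_int k" by blast
qed

lemma torus_rel_add:
  assumes "torus_rel x y" "torus_rel x' y'"
  shows "torus_rel (x + x') (y + y')"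
  unfolding torus_rel_def
proof
  fix i
  obtain k l :: int where "x $ i - y $ i = 2 * pi * of_int k" "x' $ i - y' $ i = 2 * pi * of_int l"
    using assms unfolding torus_rel_def by blast
  then have "(x + x') $ i - (y + y') $ i = 2 * pi * of_int (k + l)"
    by (simp add: algebra_simps)
  then show "\<exists>k::int. (x + x') $ i - (y + y') $ i = 2 * pi * of_int k" by blast
qed

lemma torus_rel_uminus:
  assumes "torus_rel x y"
  shows "torus_rel (- x) (- y)"
  using torus_rel_sym[OF assms] unfolding torus_rel_def by simp

lemma torus_rel_trans:
  assumes "torus_rel x y" "torus_rel y z"
  shows "torus_rel x z"
  using torus_rel_add[OF assms] unfolding torus_rel_def by simp

quotient_type (overloaded) 'n torus = "real ^ 'n" / "torus_rel :: real ^ ('n::finite) \<Rightarrow> _"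
  morphisms rep_torus to_torus
  by (intro equivpI reflpI sympI transpI)
     (auto intro: torus_rel_refl torus_rel_sym torus_rel_trans)

instantiation torus :: (finite) ab_group_add
begin

lift_definition zero_torus :: "'a torus" is 0 .

lift_definition plus_torus :: "'a torus \<Rightarrow> 'a torus \<Rightarrow> 'a torus" is "(+)"
  by (rule torus_rel_add)

lift_definition uminus_torus :: "'a torus \<Rightarrow> 'a torus" is uminus
  by (rule torus_rel_uminus)

lift_definition minus_torus :: "'a torus \<Rightarrow> 'a torus \<Rightarrow> 'a torus" is "(-)"
  using torus_rel_add torus_rel_uminus by fastforce

instance
  by standard (transfer, simp add: torus_rel_refl algebra_simps)+

end

text \<open>The quotient topology.\<close>

instantiation torus :: (finite) topological_space
begin

definition open_torus :: "'a torus set \<Rightarrow> bool" where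
  "open_torus U \<longleftrightarrow> open (to_torus -` U)"

instance
  by standard (auto simp: open_torus_def vimage_Union)

end

lemma continuous_on_to_torus: "continuous_on UNIV (to_torus :: real ^ 'n \<Rightarrow> 'n::finite torus)"
  by (simp add: continuous_on_open_vimage open_torus_def)

text \<open>
  The flat distance to \<open>0\<close>. A minimizing geodesic lifts to a straight segment starting at \<open>0\<close>,
  so its length is the least norm of a lift.
\<close>

definition torus_norm :: "'n::finite torus \<Rightarrow> real" where
  "torus_norm x = (INF y \<in> {y. to_torus y = x}. norm y)"

text \<open>
  Lebesgue measure on the torus (total mass \<open>(2\<pi>)\<^sup>n\<close>), transported from a fundamental domain.
\<close>

definition torus_lborel :: "'n::finite torus measure" where
  "torus_lborel =
     distr (restrict_space lborel {y :: real ^ 'n. \<forall>i. 0 \<le> y $ i \<and> y $ i < 2 * pi}) borel to_torus"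

lemma measurable_to_torus:
  "to_torus \<in> restrict_space lborel {y :: real ^ 'n. \<forall>i. 0 \<le> y $ i \<and> y $ i < 2 * pi}
     \<rightarrow>\<^sub>M (borel :: 'n::finite torus measure)"
proof -
  have "to_torus \<in> borel \<rightarrow>\<^sub>M (borel :: 'n torus measure)"
    by (rule borel_measurable_continuous_onI[OF continuous_on_to_torus])
  then show ?thesis
    by (intro measurable_restrict_space1) simp
qed

text \<open>
  The smooth structure of the torus is the one making the covering map \<^term>\<open>to_torus\<close> a local
  diffeomorphism: derivatives of maps into and out of the torus are taken after lifting.
\<close>

definition has_torus_derivative ::
  "(real \<Rightarrow> 'n::finite torus) \<Rightarrow> real ^ 'n \<Rightarrow> real \<Rightarrow> real set \<Rightarrow> bool" where
  "has_torus_derivative x w t S \<longleftrightarrow>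
     (\<exists>y e. e > 0 \<and> (\<forall>s \<in> insert t S. dist s t < e \<longrightarrow> to_torus (y s) = x s) \<and>
            (y has_vector_derivative w) (at t within S))"

definition C1_on_torus :: "('n::finite torus \<Rightarrow> real) \<Rightarrow> bool" where
  "C1_on_torus \<phi> \<longleftrightarrow>
     (\<exists>D :: real ^ 'n \<Rightarrow> (real ^ 'n) \<Rightarrow>\<^sub>L real. continuous_on UNIV D \<and>
        (\<forall>y. ((\<lambda>z. \<phi> (to_torus z)) has_derivative blinfun_apply (D y)) (at y)))"

section \<open>Local kernels and the alignment system\<close>

definition strictly_local_kernel :: "('n::finite torus \<Rightarrow> real) \<Rightarrow> real \<Rightarrow> bool" where
  "strictly_local_kernel \<phi> r0 \<longleftrightarrow>
     r0 > 0 \<and> C1_on_torus \<phi> \<and> (\<forall>x. \<phi> x \<ge> 0) \<and>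
     (\<forall>x y. torus_norm x \<le> torus_norm y \<longrightarrow> \<phi> y \<le> \<phi> x) \<and>
     (\<forall>x. torus_norm x < r0 \<longrightarrow> \<phi> x > 0) \<and>
     (\<forall>x. torus_norm x \<ge> r0 \<longrightarrow> \<phi> x = 0)"

text \<open>Agents are indexed by the finite type \<^typ>\<open>'m\<close>; \<open>N\<close> is its cardinality.\<close>

definition alignment_solution ::
  "('n::finite torus \<Rightarrow> real) \<Rightarrow> ('m::finite \<Rightarrow> 'n torus) \<Rightarrow> ('m \<Rightarrow> real ^ 'n) \<Rightarrow>
   (real \<Rightarrow> 'm \<Rightarrow> 'n torus) \<Rightarrow> (real \<Rightarrow> 'm \<Rightarrow> real ^ 'n) \<Rightarrow> bool" where
  "alignment_solution \<phi> x0 v0 x v \<longleftrightarrow>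
     x 0 = x0 \<and> v 0 = v0 \<and>
     (\<forall>t\<ge>0. \<forall>i.
        has_torus_derivative (\<lambda>s. x s i) (v t i) t {0..} \<and>
        ((\<lambda>s. v s i) has_vector_derivative
           (1 / real CARD('m)) *\<^sub>R (\<Sum>j\<in>UNIV. \<phi> (x t i - x t j) *\<^sub>R (v t j - v t i)))
          (at t within {0..}))"

end

theory Submission imports Defs begin

text \<open>
  If the total interaction of a solution is finite, all velocities converge and, by Barbalat's lemma,
  \<open>\<phi>(x\<^sub>a - x\<^sub>b)\<close> tends to \<open>0\<close> for every pair \<open>a \<noteq> b\<close>. The relative motion is asymptotically
  a straight line on the torus in the direction \<open>v\<^sub>a\<^sup>\<infinity> - v\<^sub>b\<^sup>\<infinity>\<close>; by Kronecker's theorem such a line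
  enters every ball unless its direction is annihilated by some non-zero integer vector \<open>k\<close>. So bad
  data have resonant limit velocities, which form a null set.

  This null set has to be pulled back along the flow. The flow contracts phase space volume at time
  \<open>T\<close> only by the factor \<open>exp (- (n/N) \<integral>\<^sub>0\<^sup>T \<Sum> \<phi>\<^sub>i\<^sub>j)\<close>, which stays away from \<open>0\<close> on bad data. To
  avoid differentiating the flow, it is approximated by a splitting scheme that updates one agent at a
  time: its Jacobian is an explicit product, its convergence needs only Lipschitz estimates along a
  given solution, and Fatou's lemma transports the volume bound to the limit. A bound that is worse by
  a constant factor in the exponent is sufficient.
\<close>

section \<open>The torus\<close>

text \<open>The pull-back cannot be carried out at time infinity: limit velocities depend on the
  datum in an uncontrolled way, and the set of bad data is not known to be measurable. So the
  resonant hyperplane is thickened to slabs \<open>thin\<close> of width of order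
  \<open>1 / (p + 1)\<close>, which the velocities of a bad datum enter in finite time and never
  leave again. The bad data are then caught by a Borel function \<open>G\<close> with integral
  \<open>0\<close> that is positive at each of them. All approximants are finite compositions of
  Borel maps, so measurability is checked only for them, and their convergence is proved along one
  arbitrary given solution. The slabs are cut off at speed \<open>R\<close> to have finite measure;
  the dynamics respects the cut-off because every kick forms a convex combination of velocities.
  Countably many pairs \<open>(k, R)\<close> exhaust the bad data. The loss in the exponent has two
  sources: \<open>1 - u\<close> is replaced by \<open>exp (- 2 u)\<close> factor by factor, and a
  slack of \<open>1\<close> absorbs the discretization error.\<close>

lemma to_torus_eq_iff: "to_torus x = to_torus y \<longleftrightarrow> torus_rel x y"
  by (rule torus.abs_eq_iff)

lemma to_torus_rep [simp]: "to_torus (rep_torus p) = p"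
  using Quotient3_torus Quotient3_abs_rep by fastforce

lemma to_torus_add: "to_torus (x + y) = to_torus x + to_torus y"
  by (simp add: plus_torus.abs_eq)

lemma to_torus_diff: "to_torus (x - y) = to_torus x - to_torus y"
  by (simp add: minus_torus.abs_eq)

definition torus_lattice :: "(real ^ 'n) set" where
  "torus_lattice = {l. \<forall>i. \<exists>k::int. l $ i = 2 * pi * of_int k}"

lemma torus_rel_iff_lattice: "torus_rel x y \<longleftrightarrow> x - y \<in> torus_lattice"
  by (simp add: torus_rel_def torus_lattice_def)

lemma torus_lattice_uminus: "l \<in> torus_lattice \<Longrightarrow> - l \<in> torus_lattice"
  using torus_rel_sym[of l 0] by (simp add: torus_rel_iff_lattice)

lemma to_torus_eq_iff_lattice: "to_torus x = to_torus y \<longleftrightarrow> x - y \<in> torus_lattice"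
  by (simp add: to_torus_eq_iff torus_rel_iff_lattice)

lemma to_torus_add_lattice: "l \<in> torus_lattice \<Longrightarrow> to_torus (x + l) = to_torus x"
  by (simp add: to_torus_eq_iff_lattice)

lemma countable_torus_lattice: "countable (torus_lattice :: (real ^ 'n::finite) set)"
proof -
  have "torus_lattice \<subseteq> range (\<lambda>f :: 'n \<Rightarrow> int. \<chi> i. 2 * pi * of_int (f i))"
  proof
    fix l :: "real ^ 'n"
    assume "l \<in> torus_lattice"
    then have "\<forall>i. \<exists>k::int. l $ i = 2 * pi * of_int k" by (simp add: torus_lattice_def)
    then obtain f :: "'n \<Rightarrow> int" where "\<forall>i. l $ i = 2 * pi * of_int (f i)" by metis
    then have "l = (\<chi> i. 2 * pi * of_int (f i))" by (simp add: vec_eq_iff)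
    then show "l \<in> range (\<lambda>f :: 'n \<Rightarrow> int. \<chi> i. 2 * pi * of_int (f i))" by blast
  qed
  then show ?thesis
    by (rule countable_subset) simp
qed

lemma open_to_torus_image:
  fixes U :: "(real ^ 'n::finite) set"
  assumes "open U"
  shows "open (to_torus ` U)"
proof -
  have "to_torus -` to_torus ` U = (\<Union>l\<in>torus_lattice. (+) l ` U)"
  proof (intro equalityI subsetI)
    fix x :: "real ^ 'n"
    assume "x \<in> to_torus -` to_torus ` U"
    then obtain u where "u \<in> U" "x - u \<in> torus_lattice"
      by (auto simp: to_torus_eq_iff_lattice)
    then show "x \<in> (\<Union>l\<in>torus_lattice. (+) l ` U)"
      by (intro UN_I[of "x - u"] image_eqI[of _ _ u]) auto
  next
    fix x :: "real ^ 'n"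
    assume "x \<in> (\<Union>l\<in>torus_lattice. (+) l ` U)"
    then obtain l u where "l \<in> torus_lattice" "u \<in> U" "x = u + l"
      by (auto simp: add.commute)
    then show "x \<in> to_torus -` to_torus ` U"
      by (simp add: to_torus_add_lattice)
  qed
  then show ?thesis
    using assms by (auto simp: open_torus_def intro!: open_translation)
qed

text \<open>A countable base makes the Borel sets of a product of two tori generated by boxes.
  \<open>borel_measurable_Pair\<close>, and with it the measurability of differences of positions,
  rests on this.\<close>

instance torus :: (finite) second_countable_topology
proof
  obtain B :: "(real ^ 'a) set set" where B: "countable B" "topological_basis B"
    using ex_countable_basis by blast
  have "topological_basis ((`) to_torus ` B)"
    unfolding topological_basis_def
  proof (intro conjI ballI allI impI)
    fix U :: "'a torus set"
    assume "U \<in> (`) to_torus ` B"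
    then show "open U"
      using B(2) by (auto simp: topological_basis_open intro: open_to_torus_image)
  next
    fix U :: "'a torus set"
    assume "open U"
    then have "open (to_torus -` U)" by (simp add: open_torus_def)
    then obtain C where C: "C \<subseteq> B" "\<Union>C = to_torus -` U"
      using B(2) unfolding topological_basis_def by blast
    have "\<Union>((`) to_torus ` C) = to_torus ` \<Union>C" by blast
    also have "\<dots> = U"
      unfolding C(2) by (rule surj_image_vimage_eq) (metis surjI to_torus_rep)
    finally show "\<exists>B'. B' \<subseteq> (`) to_torus ` B \<and> \<Union>B' = U"
      using C(1) by (intro exI[of _ "(`) to_torus ` C"]) auto
  qed
  then show "\<exists>B :: 'a torus set set. countable B \<and> open = generate_topology B"
    using B(1) by (metis countable_image topological_basis_imp_subbasis)
qed

text \<open>The topology on pairs is the product topology, not a quotient of the topology on pairs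
  of lifts. The two agree here because \<open>to_torus\<close> is open: a box around lifts projects
  to an open box around the points.\<close>

lemma continuous_on_torus_diff:
  "continuous_on UNIV (\<lambda>z :: 'n::finite torus \<times> 'n torus. fst z - snd z)"
proof (subst continuous_on_open_vimage[OF open_UNIV], intro allI impI)
  fix U :: "'n torus set"
  assume "open U"
  show "open ((\<lambda>z :: 'n torus \<times> 'n torus. fst z - snd z) -` U \<inter> UNIV)"
  proof (rule open_prod_intro)
    fix z :: "'n torus \<times> 'n torus"
    assume z: "z \<in> (\<lambda>z. fst z - snd z) -` U \<inter> UNIV"
    define p q where "p = rep_torus (fst z)" and "q = rep_torus (snd z)"
    have "open ((\<lambda>y :: (real ^ 'n) \<times> (real ^ 'n). fst y - snd y) -` (to_torus -` U))"
      using \<open>open U\<close> unfolding open_torus_def by (rule open_vimage) (intro continuous_intros)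
    moreover have "(p, q) \<in> (\<lambda>y. fst y - snd y) -` (to_torus -` U)"
      using z by (simp add: p_def q_def to_torus_diff)
    ultimately obtain A B where AB: "open A" "open B" "(p, q) \<in> A \<times> B"
      "A \<times> B \<subseteq> (\<lambda>y. fst y - snd y) -` (to_torus -` U)"
      by (rule open_prod_elim)
    have "z \<in> to_torus ` A \<times> to_torus ` B"
      using AB(3) imageI[of p A to_torus] imageI[of q B to_torus] by (cases z) (simp add: p_def q_def)
    moreover have "to_torus ` A \<times> to_torus ` B \<subseteq> (\<lambda>z. fst z - snd z) -` U \<inter> UNIV"
      using AB(4) by (auto simp: to_torus_diff)
    ultimately show "\<exists>A B. open A \<and> open B \<and> z \<in> A \<times> B \<and> A \<times> B \<subseteq> (\<lambda>z. fst z - snd z) -` U \<inter> UNIV"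
      using open_to_torus_image[OF AB(1)] open_to_torus_image[OF AB(2)] by blast
  qed
qed

lemma borel_measurable_to_torus [measurable]:
  "to_torus \<in> borel \<rightarrow>\<^sub>M (borel :: 'n::finite torus measure)"
  by (rule borel_measurable_continuous_onI[OF continuous_on_to_torus])

lemma borel_measurable_torus_diff [measurable (raw)]:
  fixes f g :: "'a \<Rightarrow> 'n::finite torus"
  assumes "f \<in> borel_measurable M" "g \<in> borel_measurable M"
  shows "(\<lambda>x. f x - g x) \<in> borel_measurable M"
  using borel_measurable_continuous_on[OF continuous_on_torus_diff borel_measurable_Pair[OF assms]]
  by simp

lemma borel_measurable_torus_add [measurable (raw)]:
  fixes f g :: "'a \<Rightarrow> 'n::finite torus"
  assumes "f \<in> borel_measurable M" "g \<in> borel_measurable M"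
  shows "(\<lambda>x. f x + g x) \<in> borel_measurable M"
proof -
  have "(\<lambda>x. f x - ((0 :: 'n torus) - g x)) \<in> borel_measurable M"
    using assms by (intro borel_measurable_torus_diff) auto
  then show ?thesis by simp
qed

section \<open>Lebesgue measure on the torus and its invariance under translations\<close>

definition torus_cube :: "(real ^ 'n) set" where
  "torus_cube = {y. \<forall>i. 0 \<le> y $ i \<and> y $ i < 2 * pi}"

lemma torus_cube_measurable [measurable]: "torus_cube \<in> sets (borel :: (real ^ 'n::finite) measure)"
proof -
  have "torus_cube = (\<Inter>i. {y :: real ^ 'n. 0 \<le> y $ i} \<inter> {y. y $ i < 2 * pi})"
    by (auto simp: torus_cube_def)
  also have "\<dots> \<in> sets borel"
    by (intro sets.countable_INT'' sets.Int borel_closed borel_open closed_halfspace_component_ge_cart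
        open_halfspace_component_lt_cart) (auto simp: closed_halfspace_component_ge_cart)
  finally show ?thesis .
qed

lemma torus_cube_translate:
  fixes y :: "real ^ 'n::finite"
  shows "\<exists>!l. l \<in> torus_lattice \<and> y - l \<in> torus_cube"
proof (rule ex1I)
  let ?l = "(\<chi> i. 2 * pi * of_int \<lfloor>y $ i / (2 * pi)\<rfloor>) :: real ^ 'n"
  show "?l \<in> torus_lattice \<and> y - ?l \<in> torus_cube"
  proof
    show "?l \<in> torus_lattice" by (auto simp: torus_lattice_def)
    have "0 \<le> y $ i - 2 * pi * of_int \<lfloor>y $ i / (2 * pi)\<rfloor>
        \<and> y $ i - 2 * pi * of_int \<lfloor>y $ i / (2 * pi)\<rfloor> < 2 * pi" for i
      using floor_divide_lower[of "2 * pi" "y $ i"] floor_divide_upper[of "2 * pi" "y $ i"]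
      by (simp add: algebra_simps)
    then show "y - ?l \<in> torus_cube" by (simp add: torus_cube_def)
  qed
  fix l :: "real ^ 'n"
  assume l: "l \<in> torus_lattice \<and> y - l \<in> torus_cube"
  have "l $ i = ?l $ i" for i
  proof -
    obtain k :: int where k: "l $ i = 2 * pi * of_int k"
      using l by (auto simp: torus_lattice_def)
    have "0 \<le> y $ i - 2 * pi * of_int k" "y $ i - 2 * pi * of_int k < 2 * pi"
      using l by (auto simp: torus_cube_def k[symmetric])
    then have "of_int k \<le> y $ i / (2 * pi)" "y $ i / (2 * pi) < of_int k + 1"
      by (auto simp: field_simps)
    then have "\<lfloor>y $ i / (2 * pi)\<rfloor> = k" by linarith
    then show ?thesis using k by simp
  qed
  then show "l = ?l" by (simp add: vec_eq_iff)
qed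

lemma nn_integral_torus_lborel:
  fixes g :: "'n::finite torus \<Rightarrow> ennreal"
  assumes [measurable]: "g \<in> borel_measurable borel"
  shows "(\<integral>\<^sup>+p. g p \<partial>torus_lborel) = (\<integral>\<^sup>+y. g (to_torus y) * indicator torus_cube y \<partial>lborel)"
proof -
  have "(\<integral>\<^sup>+p. g p \<partial>torus_lborel) = (\<integral>\<^sup>+y. g (to_torus y) \<partial>restrict_space lborel torus_cube)"
    unfolding torus_lborel_def torus_cube_def
    by (intro nn_integral_distr measurable_to_torus) simp
  also have "\<dots> = (\<integral>\<^sup>+y. g (to_torus y) * indicator torus_cube y \<partial>lborel)"
    by (intro nn_integral_restrict_space) simp
  finally show ?thesis .
qed

lemma nn_integral_lborel_translate:
  fixes f :: "'a::euclidean_space \<Rightarrow> ennreal"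
  assumes [measurable]: "f \<in> borel_measurable borel"
  shows "(\<integral>\<^sup>+y. f (y + a) \<partial>lborel) = (\<integral>\<^sup>+y. f y \<partial>lborel)"
proof -
  have "(\<integral>\<^sup>+y. f y \<partial>lborel) = (\<integral>\<^sup>+y. f y \<partial>distr lborel borel ((+) a))"
    by (simp add: lborel_distr_plus)
  also have "\<dots> = (\<integral>\<^sup>+y. f (a + y) \<partial>lborel)"
    by (intro nn_integral_distr) auto
  finally show ?thesis by (simp add: add.commute)
qed

lemma nn_integral_indicator_lattice:
  fixes y :: "real ^ 'n::finite"
  shows "(\<integral>\<^sup>+l. indicator torus_cube (y - l) \<partial>count_space torus_lattice) = 1"
proof -
  obtain l0 where l0: "l0 \<in> torus_lattice" "y - l0 \<in> torus_cube"
    "\<And>l. l \<in> torus_lattice \<Longrightarrow> y - l \<in> torus_cube \<Longrightarrow> l = l0"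
    using torus_cube_translate[of y] by blast
  have "(indicator torus_cube (y - l) :: ennreal) = indicator {l0} l" if "l \<in> torus_lattice" for l
    using l0(2) l0(3)[OF that] by (cases "l = l0") (simp_all add: indicator_def, blast)
  then have "(\<integral>\<^sup>+l. indicator torus_cube (y - l) \<partial>count_space torus_lattice)
      = (\<integral>\<^sup>+l. indicator {l0} l \<partial>count_space torus_lattice)"
    by (intro nn_integral_cong) simp
  also have "\<dots> = 1" using l0(1) by simp
  finally show ?thesis .
qed

text \<open>
  Unfold \<open>g\<close> to a periodic function, insert the partition of unity formed by the lattice
  translates of the cube, and let the translated and the untranslated cube exchange roles.
\<close>

lemma nn_integral_torus_translate:
  fixes g :: "'n::finite torus \<Rightarrow> ennreal"
  assumes g[measurable]: "g \<in> borel_measurable borel"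
  shows "(\<integral>\<^sup>+p. g (p + a) \<partial>torus_lborel) = (\<integral>\<^sup>+p. g p \<partial>torus_lborel)"
proof -
  let ?Q = "indicator torus_cube :: real ^ 'n \<Rightarrow> ennreal"
  let ?L = "count_space torus_lattice :: (real ^ 'n) measure"
  define c where "c = rep_torus a"
  have c: "to_torus (y + c) = to_torus y + a" for y
    by (simp add: c_def to_torus_add)
  have gt[measurable]: "(\<lambda>y. g (to_torus y)) \<in> borel_measurable borel" by measurable
  have lat: "g (to_torus (y + l)) = g (to_torus y)" if "l \<in> torus_lattice" for y l
    using that by (simp add: to_torus_add_lattice)
  have "(\<integral>\<^sup>+p. g (p + a) \<partial>torus_lborel) = (\<integral>\<^sup>+y. g (to_torus (y + c)) * ?Q (y + c - c) \<partial>lborel)"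
    by (subst nn_integral_torus_lborel) (auto simp: c)
  also have "\<dots> = (\<integral>\<^sup>+y. g (to_torus y) * ?Q (y - c) \<partial>lborel)"
    by (rule nn_integral_lborel_translate) measurable
  also have "\<dots> = (\<integral>\<^sup>+y. (\<integral>\<^sup>+l. g (to_torus y) * ?Q (y - c) * ?Q (y - l) \<partial>?L) \<partial>lborel)"
    by (simp add: nn_integral_cmult nn_integral_indicator_lattice)
  also have "\<dots> = (\<integral>\<^sup>+l. (\<integral>\<^sup>+y. g (to_torus y) * ?Q (y - c) * ?Q (y - l) \<partial>lborel) \<partial>?L)"
    by (rule nn_integral_count_space_nn_integral[OF countable_torus_lattice]) measurable
  also have "\<dots> = (\<integral>\<^sup>+l. (\<integral>\<^sup>+y. g (to_torus y) * ?Q y * ?Q (y - c + l) \<partial>lborel) \<partial>?L)"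
  proof (rule nn_integral_cong)
    fix l :: "real ^ 'n"
    assume "l \<in> space ?L"
    then have l: "l \<in> torus_lattice" by simp
    have "(\<integral>\<^sup>+y. g (to_torus y) * ?Q (y - c) * ?Q (y - l) \<partial>lborel)
        = (\<integral>\<^sup>+y. g (to_torus (y + l)) * ?Q (y + l - c) * ?Q (y + l - l) \<partial>lborel)"
      by (rule nn_integral_lborel_translate[symmetric]) measurable
    also have "\<dots> = (\<integral>\<^sup>+y. g (to_torus y) * ?Q y * ?Q (y - c + l) \<partial>lborel)"
      using l by (simp add: lat algebra_simps)
    finally show "(\<integral>\<^sup>+y. g (to_torus y) * ?Q (y - c) * ?Q (y - l) \<partial>lborel)
        = (\<integral>\<^sup>+y. g (to_torus y) * ?Q y * ?Q (y - c + l) \<partial>lborel)" .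
  qed
  also have "\<dots> = (\<integral>\<^sup>+y. (\<integral>\<^sup>+l. g (to_torus y) * ?Q y * ?Q (y - c + l) \<partial>?L) \<partial>lborel)"
    by (rule nn_integral_count_space_nn_integral[OF countable_torus_lattice, symmetric]) measurable
  also have "\<dots> = (\<integral>\<^sup>+y. g (to_torus y) * ?Q y \<partial>lborel)"
  proof (rule nn_integral_cong)
    fix y :: "real ^ 'n"
    \<comment> \<open>After the substitution the lattice vector carries a plus sign; reflecting the
      lattice restores the form of \<open>nn_integral_indicator_lattice\<close>.\<close>
    have "bij_betw uminus torus_lattice (torus_lattice :: (real ^ 'n) set)"
      by (rule bij_betw_byWitness[of _ uminus]) (auto simp: torus_lattice_uminus)
    then have "(\<integral>\<^sup>+l. ?Q (y - c + l) \<partial>?L) = (\<integral>\<^sup>+l. ?Q (y - c + - l) \<partial>?L)"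
      by (rule nn_integral_bij_count_space[symmetric])
    also have "\<dots> = 1"
      using nn_integral_indicator_lattice[of "y - c"] by simp
    finally have "(\<integral>\<^sup>+l. ?Q (y - c + l) \<partial>?L) = 1" .
    then show "(\<integral>\<^sup>+l. g (to_torus y) * ?Q y * ?Q (y - c + l) \<partial>?L) = g (to_torus y) * ?Q y"
      by (simp add: nn_integral_cmult)
  qed
  also have "\<dots> = (\<integral>\<^sup>+p. g p \<partial>torus_lborel)"
    by (simp add: nn_integral_torus_lborel)
  finally show ?thesis .
qed

lemma space_torus_lborel [simp]: "space torus_lborel = UNIV"
  by (simp add: torus_lborel_def)

lemma sets_torus_lborel [simp, measurable_cong]: "sets torus_lborel = sets borel"
  by (simp add: torus_lborel_def)

lemma finite_measure_torus_lborel: "finite_measure (torus_lborel :: 'n::finite torus measure)"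
proof (rule finite_measureI)
  have "bounded (torus_cube :: (real ^ 'n) set)"
    by (rule bounded_subset[OF bounded_cbox[of 0 "\<chi> i. 2 * pi"]])
       (auto simp: torus_cube_def mem_box_cart less_imp_le)
  then have "emeasure lborel (torus_cube :: (real ^ 'n) set) < \<infinity>"
    by (rule emeasure_bounded_finite)
  moreover have "emeasure torus_lborel (space (torus_lborel :: 'n torus measure))
      = (\<integral>\<^sup>+p. 1 \<partial>(torus_lborel :: 'n torus measure))"
    by simp
  then have "emeasure torus_lborel (space (torus_lborel :: 'n torus measure))
      = emeasure lborel (torus_cube :: (real ^ 'n) set)"
    by (subst (asm) nn_integral_torus_lborel) auto
  ultimately show "emeasure torus_lborel (space (torus_lborel :: 'n torus measure)) \<noteq> \<infinity>"
    by simp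
qed

lemma torus_norm_nonneg: "0 \<le> torus_norm (p :: 'n::finite torus)"
  unfolding torus_norm_def by (rule cINF_greatest) (auto intro: exI[of _ "rep_torus p"])

lemma torus_norm_le: "torus_norm (to_torus y :: 'n::finite torus) \<le> norm y"
  unfolding torus_norm_def by (rule cINF_lower) (auto intro!: bdd_belowI[of _ 0])

lemma sigma_finite_torus_lborel: "sigma_finite_measure (torus_lborel :: 'n::finite torus measure)"
proof -
  interpret finite_measure "torus_lborel :: 'n torus measure"
    by (rule finite_measure_torus_lborel)
  show ?thesis by (rule sigma_finite_measure_axioms)
qed

section \<open>A splitting scheme with explicit Jacobian\<close>

lemma nn_integral_lborel_affine:
  fixes f :: "'a::euclidean_space \<Rightarrow> ennreal"
  assumes [measurable]: "f \<in> borel_measurable borel" and c: "c > 0"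
  shows "(\<integral>\<^sup>+y. ennreal (c ^ DIM('a)) * f (b + c *\<^sub>R y) \<partial>lborel) = (\<integral>\<^sup>+y. f y \<partial>lborel)"
proof -
  have "(\<integral>\<^sup>+y. f y \<partial>lborel)
      = (\<integral>\<^sup>+y. f y \<partial>density (distr lborel borel (\<lambda>x. b + c *\<^sub>R x)) (\<lambda>_. ennreal (\<bar>c\<bar> ^ DIM('a))))"
    using lborel_affine[of c b] c by simp
  also have "\<dots> = (\<integral>\<^sup>+y. ennreal (\<bar>c\<bar> ^ DIM('a)) * f y \<partial>distr lborel borel (\<lambda>x. b + c *\<^sub>R x))"
    by (rule nn_integral_density) auto
  also have "\<dots> = (\<integral>\<^sup>+y. ennreal (c ^ DIM('a)) * f (b + c *\<^sub>R y) \<partial>lborel)"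
    using c by (subst nn_integral_distr) auto
  finally show ?thesis by simp
qed

text \<open>Fubini with coordinate \<open>i\<close> innermost: a map that alters only this
  coordinate inherits the Jacobian of its sections. Both \<open>c\<close> and \<open>T\<close> may
  look at the whole point, which is why \<open>inv\<close> evaluates them at
  \<open>x(i := y)\<close>.\<close>

lemma nn_integral_PiM_component:
  fixes M :: "'a measure" and T :: "('m::finite \<Rightarrow> 'a) \<Rightarrow> 'a \<Rightarrow> 'a" and c :: "('m \<Rightarrow> 'a) \<Rightarrow> ennreal"
  assumes sf: "sigma_finite_measure M" and sp: "space M = UNIV"
    and inv: "\<And>x g. g \<in> borel_measurable M \<Longrightarrow> (\<integral>\<^sup>+y. c (x(i := y)) * g (T (x(i := y)) y) \<partial>M) = (\<integral>\<^sup>+y. g y \<partial>M)"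
    and f[measurable]: "f \<in> borel_measurable (\<Pi>\<^sub>M i\<in>(UNIV :: 'm set). M)"
    and cf: "(\<lambda>x. c x * f (x(i := T x (x i)))) \<in> borel_measurable (\<Pi>\<^sub>M i\<in>(UNIV :: 'm set). M)"
  shows "(\<integral>\<^sup>+x. c x * f (x(i := T x (x i))) \<partial>(\<Pi>\<^sub>M i\<in>(UNIV :: 'm set). M)) = (\<integral>\<^sup>+x. f x \<partial>(\<Pi>\<^sub>M i\<in>(UNIV :: 'm set). M))"
proof -
  interpret product_sigma_finite "\<lambda>_ :: 'm. M"
    using sf by (simp add: product_sigma_finite_def)
  have U: "insert i (UNIV - {i}) = UNIV" by auto
  have "(\<integral>\<^sup>+x. c x * f (x(i := T x (x i))) \<partial>(\<Pi>\<^sub>M i\<in>(UNIV :: 'm set). M))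
      = (\<integral>\<^sup>+x. (\<integral>\<^sup>+y. c (x(i := y)) * f (x(i := T (x(i := y)) y)) \<partial>M) \<partial>(\<Pi>\<^sub>M i\<in>UNIV - {i}. M))"
    using product_nn_integral_insert[of "UNIV - {i}" i "\<lambda>x. c x * f (x(i := T x (x i)))"] cf
    by (simp add: U)
  also have "\<dots> = (\<integral>\<^sup>+x. (\<integral>\<^sup>+y. f (x(i := y)) \<partial>M) \<partial>(\<Pi>\<^sub>M i\<in>UNIV - {i}. M))"
  proof (rule nn_integral_cong)
    fix x assume x: "x \<in> space (\<Pi>\<^sub>M i\<in>UNIV - {i}. M)"
    have "(\<lambda>y. x(i := y)) \<in> M \<rightarrow>\<^sub>M (\<Pi>\<^sub>M i\<in>(UNIV :: 'm set). M)"
      using x by (intro measurable_fun_upd[where J = "UNIV - {i}"]) (auto intro: measurable_const)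
    then have "(\<lambda>y. f (x(i := y))) \<in> borel_measurable M"
      by measurable
    then show "(\<integral>\<^sup>+y. c (x(i := y)) * f (x(i := T (x(i := y)) y)) \<partial>M) = (\<integral>\<^sup>+y. f (x(i := y)) \<partial>M)"
      using inv[of "\<lambda>y. f (x(i := y))" x] by simp
  qed
  also have "\<dots> = (\<integral>\<^sup>+x. f x \<partial>(\<Pi>\<^sub>M i\<in>(UNIV :: 'm set). M))"
    using product_nn_integral_insert[of "UNIV - {i}" i f] by (simp add: U)
  finally show ?thesis .
qed

lemma borel_measurable_vec_component [measurable (raw)]:
  "f \<in> borel_measurable M \<Longrightarrow> (\<lambda>z. (f z :: real ^ 'n::finite) $ c) \<in> borel_measurable M"
  by (rule measurable_compose[OF _ borel_measurable_continuous_onI]) (auto intro!: continuous_intros)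

section \<open>The kernel, the damping rates and the splitting scheme\<close>

locale local_kernel =
  fixes \<phi> :: "'n::finite torus \<Rightarrow> real" and r0 :: real
  assumes kernel: "strictly_local_kernel \<phi> r0"
begin

lemma r0_pos: "r0 > 0"
  using kernel by (simp add: strictly_local_kernel_def)

lemma kernel_nonneg: "0 \<le> \<phi> p"
  using kernel by (simp add: strictly_local_kernel_def)

lemma kernel_le: "\<phi> p \<le> \<phi> 0"
proof -
  have "torus_norm (0 :: 'n torus) \<le> 0"
    using torus_norm_le[of 0] by (simp add: zero_torus.abs_eq)
  then show ?thesis
    using kernel torus_norm_nonneg[of p] unfolding strictly_local_kernel_def
    by (meson order_trans)
qed

lemma kernel_pos: "norm y < r0 \<Longrightarrow> 0 < \<phi> (to_torus y)"
  using kernel torus_norm_le[of y] by (auto simp: strictly_local_kernel_def)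

lemma kernel_derivative:
  obtains D :: "real ^ 'n \<Rightarrow> (real ^ 'n) \<Rightarrow>\<^sub>L real" where "continuous_on UNIV D"
    "\<And>y. ((\<lambda>z. \<phi> (to_torus z)) has_derivative blinfun_apply (D y)) (at y)"
  using kernel unfolding strictly_local_kernel_def C1_on_torus_def by blast

lemma continuous_on_kernel: "continuous_on UNIV (\<lambda>y. \<phi> (to_torus y))"
  by (rule kernel_derivative)
     (meson continuous_at_imp_continuous_on has_derivative_continuous)

lemma borel_measurable_kernel [measurable]: "\<phi> \<in> borel_measurable borel"
proof (rule borel_measurable_continuous_onI, subst continuous_on_open_vimage[OF open_UNIV], intro allI impI)
  fix B :: "real set"
  assume "open B"
  then have "open ((\<lambda>y. \<phi> (to_torus y)) -` B)"
    using continuous_on_kernel by (simp add: open_vimage)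
  then show "open (\<phi> -` B \<inter> UNIV)"
    by (simp add: open_torus_def vimage_def)
qed

text \<open>The damping coefficient with which \<open>v i\<close> enters its own equation; the term
  \<open>j = i\<close> is left out because \<open>v i - v i\<close> vanishes. The divergence of the
  vector field is \<open>- CARD('n)\<close> times the sum of the rates.\<close>

definition rate :: "'m::finite \<Rightarrow> ('m \<Rightarrow> 'n torus) \<Rightarrow> real" where
  "rate i x = (\<Sum>j\<in>UNIV - {i}. \<phi> (x i - x j)) / real CARD('m)"

lemma rate_nonneg: "0 \<le> rate i x"
  by (simp add: rate_def sum_nonneg kernel_nonneg)

lemma rate_le: "rate (i :: 'm::finite) x \<le> \<phi> 0"
proof -
  have "(\<Sum>j\<in>UNIV - {i}. \<phi> (x i - x j)) \<le> real (card (UNIV - {i})) * \<phi> 0"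
    using sum_bounded_above[of "UNIV - {i}" "\<lambda>j. \<phi> (x i - x j)" "\<phi> 0"] kernel_le by simp
  also have "\<dots> \<le> real CARD('m) * \<phi> 0"
    by (intro mult_right_mono kernel_nonneg) (simp add: card_Diff_subset)
  finally show ?thesis
    by (simp add: rate_def divide_le_eq mult.commute)
qed

definition drift :: "real \<Rightarrow> 'm \<Rightarrow> ('m \<Rightarrow> 'n torus) \<times> ('m \<Rightarrow> real ^ 'n) \<Rightarrow> ('m \<Rightarrow> 'n torus) \<times> ('m \<Rightarrow> real ^ 'n)"
  where "drift h i z = ((fst z)(i := fst z i + to_torus (h *\<^sub>R snd z i)), snd z)"

definition kick :: "real \<Rightarrow> 'm::finite \<Rightarrow> ('m \<Rightarrow> 'n torus) \<times> ('m \<Rightarrow> real ^ 'n) \<Rightarrow> ('m \<Rightarrow> 'n torus) \<times> ('m \<Rightarrow> real ^ 'n)"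
  where "kick h i z = (fst z, (snd z)(i := snd z i +
    (h / real CARD('m)) *\<^sub>R (\<Sum>j\<in>UNIV. \<phi> (fst z i - fst z j) *\<^sub>R (snd z j - snd z i))))"

text \<open>
  Step \<open>k\<close> moves only agent \<open>a k\<close>: first its position, then its velocity. \<open>weight\<close> is the exact
  Jacobian determinant of \<open>traj\<close>, because each \<open>drift\<close> is a translation in one coordinate of
  the phase space and each \<open>kick\<close> is affine in one coordinate.
\<close>

fun traj :: "real \<Rightarrow> (nat \<Rightarrow> 'm::finite) \<Rightarrow> nat \<Rightarrow> ('m \<Rightarrow> 'n torus) \<times> ('m \<Rightarrow> real ^ 'n) \<Rightarrow> ('m \<Rightarrow> 'n torus) \<times> ('m \<Rightarrow> real ^ 'n)"
  where
    "traj h a 0 z = z"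
  | "traj h a (Suc k) z = kick h (a k) (drift h (a k) (traj h a k z))"

fun weight :: "real \<Rightarrow> (nat \<Rightarrow> 'm::finite) \<Rightarrow> nat \<Rightarrow> ('m \<Rightarrow> 'n torus) \<times> ('m \<Rightarrow> real ^ 'n) \<Rightarrow> real"
  where
    "weight h a 0 z = 1"
  | "weight h a (Suc k) z =
       weight h a k z * (1 - h * rate (a k) (fst (drift h (a k) (traj h a k z)))) ^ CARD('n)"

abbreviation phase :: "(('m::finite \<Rightarrow> 'n torus) \<times> ('m \<Rightarrow> real ^ 'n)) measure" where
  "phase \<equiv> (\<Pi>\<^sub>M i\<in>(UNIV :: 'm set). torus_lborel) \<Otimes>\<^sub>M (\<Pi>\<^sub>M i\<in>(UNIV :: 'm set). lborel)"

lemma measurable_position [measurable]: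
  "(\<lambda>z. fst z i) \<in> borel_measurable (phase :: (('m::finite \<Rightarrow> 'n torus) \<times> ('m \<Rightarrow> real ^ 'n)) measure)"
proof -
  have "(\<lambda>x. x i) \<in> (\<Pi>\<^sub>M i\<in>(UNIV :: 'm set). torus_lborel :: 'n torus measure) \<rightarrow>\<^sub>M borel"
    using measurable_component_singleton[of i UNIV "\<lambda>_. torus_lborel :: 'n torus measure"]
    by (simp cong: measurable_cong_sets)
  then show ?thesis by measurable
qed

lemma measurable_velocity [measurable]:
  "(\<lambda>z. snd z i) \<in> borel_measurable (phase :: (('m::finite \<Rightarrow> 'n torus) \<times> ('m \<Rightarrow> real ^ 'n)) measure)"
proof -
  have "(\<lambda>x. x i) \<in> (\<Pi>\<^sub>M i\<in>(UNIV :: 'm set). lborel :: (real ^ 'n) measure) \<rightarrow>\<^sub>M borel"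
    using measurable_component_singleton[of i UNIV "\<lambda>_. lborel :: (real ^ 'n) measure"]
    by (simp cong: measurable_cong_sets)
  then show ?thesis by measurable
qed

lemma measurable_rate [measurable]: "(\<lambda>z. rate i (fst z)) \<in> borel_measurable phase"
  unfolding rate_def by measurable

lemma measurable_drift [measurable]: "drift h i \<in> phase \<rightarrow>\<^sub>M phase"
  unfolding drift_def
  by (intro measurable_Pair measurable_fun_upd[where J = UNIV]) (auto cong: measurable_cong_sets)

lemma measurable_kick [measurable]: "kick h i \<in> phase \<rightarrow>\<^sub>M phase"
  unfolding kick_def
  by (intro measurable_Pair measurable_fun_upd[where J = UNIV]) (auto cong: measurable_cong_sets)

lemma measurable_traj [measurable]: "traj h a k \<in> phase \<rightarrow>\<^sub>M phase"
proof (induction k)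
  case 0
  have "traj h a 0 = (\<lambda>z. z)" by auto
  then show ?case by simp
next
  case (Suc k)
  note [measurable] = Suc
  have "traj h a (Suc k) = (\<lambda>z. kick h (a k) (drift h (a k) (traj h a k z)))" by auto
  then show ?case by simp
qed

lemma measurable_weight [measurable]: "weight h a k \<in> borel_measurable phase"
proof (induction k)
  case 0
  have "weight h a 0 = (\<lambda>z. 1)" by auto
  then show ?case by simp
next
  case (Suc k)
  note [measurable] = Suc
  have "weight h a (Suc k) = (\<lambda>z. weight h a k z *
      (1 - h * rate (a k) (fst (drift h (a k) (traj h a k z)))) ^ CARD('n))" by auto
  then show ?case by simp
qed

lemma sigma_finite_positions:
  "sigma_finite_measure (\<Pi>\<^sub>M i\<in>(UNIV :: 'm::finite set). (torus_lborel :: 'n torus measure))"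
proof -
  interpret product_sigma_finite "\<lambda>_ :: 'm. torus_lborel :: 'n torus measure"
    by (simp add: product_sigma_finite_def sigma_finite_torus_lborel)
  show ?thesis by (rule sigma_finite) simp
qed

lemma sigma_finite_velocities:
  "sigma_finite_measure (\<Pi>\<^sub>M i\<in>(UNIV :: 'm::finite set). (lborel :: (real ^ 'n) measure))"
proof -
  interpret product_sigma_finite "\<lambda>_ :: 'm. lborel :: (real ^ 'n) measure"
    by (simp add: product_sigma_finite_def lborel.sigma_finite_measure_axioms)
  show ?thesis by (rule sigma_finite) simp
qed

lemma pair_sigma_finite_phase:
  "pair_sigma_finite (\<Pi>\<^sub>M i\<in>(UNIV :: 'm::finite set). (torus_lborel :: 'n torus measure))
     (\<Pi>\<^sub>M i\<in>(UNIV :: 'm set). (lborel :: (real ^ 'n) measure))"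
  by (simp add: pair_sigma_finite_def sigma_finite_positions sigma_finite_velocities)

text \<open>For frozen velocities the displacement \<open>h *\<^sub>R v i\<close> is constant, so
  translation invariance of the torus measure applies.\<close>

lemma nn_integral_drift:
  fixes f :: "('m::finite \<Rightarrow> 'n torus) \<times> ('m \<Rightarrow> real ^ 'n) \<Rightarrow> ennreal"
  assumes f[measurable]: "f \<in> borel_measurable phase"
  shows "(\<integral>\<^sup>+z. f (drift h i z) \<partial>phase) = (\<integral>\<^sup>+z. f z \<partial>phase)"
proof -
  interpret pair_sigma_finite "\<Pi>\<^sub>M i\<in>(UNIV :: 'm set). (torus_lborel :: 'n torus measure)"
    "\<Pi>\<^sub>M i\<in>(UNIV :: 'm set). (lborel :: (real ^ 'n) measure)"
    by (rule pair_sigma_finite_phase)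
  have "(\<integral>\<^sup>+z. f (drift h i z) \<partial>phase)
      = (\<integral>\<^sup>+v. (\<integral>\<^sup>+x. f (drift h i (x, v)) \<partial>(\<Pi>\<^sub>M i\<in>(UNIV :: 'm set). torus_lborel)) \<partial>(\<Pi>\<^sub>M i\<in>(UNIV :: 'm set). lborel))"
    by (rule nn_integral_snd[symmetric]) measurable
  also have "\<dots> = (\<integral>\<^sup>+v. (\<integral>\<^sup>+x. f (x, v) \<partial>(\<Pi>\<^sub>M i\<in>(UNIV :: 'm set). torus_lborel)) \<partial>(\<Pi>\<^sub>M i\<in>(UNIV :: 'm set). lborel))"
  proof (rule nn_integral_cong)
    fix v :: "'m \<Rightarrow> real ^ 'n"
    assume v[measurable]: "v \<in> space (\<Pi>\<^sub>M i\<in>(UNIV :: 'm set). lborel)"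
    have m: "(\<lambda>x. f (x, v)) \<in> borel_measurable (\<Pi>\<^sub>M i\<in>(UNIV :: 'm set). torus_lborel)"
      "(\<lambda>x. f (drift h i (x, v))) \<in> borel_measurable (\<Pi>\<^sub>M i\<in>(UNIV :: 'm set). torus_lborel)"
      by measurable
    show "(\<integral>\<^sup>+x. f (drift h i (x, v)) \<partial>(\<Pi>\<^sub>M i\<in>(UNIV :: 'm set). torus_lborel))
        = (\<integral>\<^sup>+x. f (x, v) \<partial>(\<Pi>\<^sub>M i\<in>(UNIV :: 'm set). torus_lborel))"
      using nn_integral_PiM_component[where M = torus_lborel and i = i and c = "\<lambda>_. 1"
          and T = "\<lambda>_ y. y + to_torus (h *\<^sub>R v i)" and f = "\<lambda>x. f (x, v)"] m
      by (simp add: drift_def nn_integral_torus_translate sigma_finite_torus_lborel cong: measurable_cong_sets)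
  qed
  also have "\<dots> = (\<integral>\<^sup>+z. f z \<partial>phase)"
    by (rule nn_integral_snd) measurable
  finally show ?thesis .
qed

text \<open>For frozen positions the new velocity of agent \<open>i\<close> is
  \<open>b v + c *\<^sub>R y\<close>, where \<open>b v\<close> does not involve the old velocity
  \<open>y\<close> of \<open>i\<close> and \<open>c = 1 - h * rate i x\<close>. As rates are at most
  \<open>\<phi> 0\<close>, the restriction on the step keeps \<open>c > 0\<close>.\<close>

lemma nn_integral_kick:
  fixes f :: "('m::finite \<Rightarrow> 'n torus) \<times> ('m \<Rightarrow> real ^ 'n) \<Rightarrow> ennreal"
  assumes f[measurable]: "f \<in> borel_measurable phase" and h: "0 \<le> h" "h * \<phi> 0 < 1"
  shows "(\<integral>\<^sup>+z. ennreal ((1 - h * rate i (fst z)) ^ CARD('n)) * f (kick h i z) \<partial>phase) = (\<integral>\<^sup>+z. f z \<partial>phase)"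
proof -
  interpret V: sigma_finite_measure "\<Pi>\<^sub>M i\<in>(UNIV :: 'm set). (lborel :: (real ^ 'n) measure)"
    by (rule sigma_finite_velocities)
  have m0: "(\<lambda>z. ennreal ((1 - h * rate i (fst z)) ^ CARD('n)) * f (kick h i z)) \<in> borel_measurable phase"
    by measurable
  have "(\<integral>\<^sup>+z. ennreal ((1 - h * rate i (fst z)) ^ CARD('n)) * f (kick h i z) \<partial>phase)
      = (\<integral>\<^sup>+x. (\<integral>\<^sup>+v. ennreal ((1 - h * rate i x) ^ CARD('n)) * f (kick h i (x, v)) \<partial>(\<Pi>\<^sub>M i\<in>(UNIV :: 'm set). lborel)) \<partial>(\<Pi>\<^sub>M i\<in>(UNIV :: 'm set). torus_lborel))"
    using V.nn_integral_fst[OF m0] by simp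
  also have "\<dots> = (\<integral>\<^sup>+x. (\<integral>\<^sup>+v. f (x, v) \<partial>(\<Pi>\<^sub>M i\<in>(UNIV :: 'm set). lborel)) \<partial>(\<Pi>\<^sub>M i\<in>(UNIV :: 'm set). torus_lborel))"
  proof (rule nn_integral_cong)
    fix x :: "'m \<Rightarrow> 'n torus"
    assume x[measurable]: "x \<in> space (\<Pi>\<^sub>M i\<in>(UNIV :: 'm set). torus_lborel)"
    define c where "c = 1 - h * rate i x"
    have "h * rate i x \<le> h * \<phi> 0" using h rate_le by (intro mult_left_mono) auto
    then have c: "c > 0" using h by (simp add: c_def)
    define T where "T v y = y + (h / real CARD('m)) *\<^sub>R (\<Sum>j\<in>UNIV. \<phi> (x i - x j) *\<^sub>R (v j - v i))"
      for v :: "'m \<Rightarrow> real ^ 'n" and y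
    define b where "b v = (h / real CARD('m)) *\<^sub>R (\<Sum>j\<in>UNIV - {i}. \<phi> (x i - x j) *\<^sub>R v j)"
      for v :: "'m \<Rightarrow> real ^ 'n"
    have T: "T (v(i := y)) y = b v + c *\<^sub>R y" for v y
    proof -
      have "(\<Sum>j\<in>UNIV. \<phi> (x i - x j) *\<^sub>R ((v(i := y)) j - (v(i := y)) i))
          = (\<Sum>j\<in>UNIV - {i}. \<phi> (x i - x j) *\<^sub>R ((v(i := y)) j - y))"
        by (subst sum.remove[of UNIV i]) auto
      also have "\<dots> = (\<Sum>j\<in>UNIV - {i}. \<phi> (x i - x j) *\<^sub>R v j) - (\<Sum>j\<in>UNIV - {i}. \<phi> (x i - x j)) *\<^sub>R y"
        by (simp add: scaleR_diff_right sum_subtractf scaleR_sum_left)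
      finally show ?thesis
        unfolding T_def b_def c_def rate_def
        by (simp only: scaleR_diff_right scaleR_diff_left scaleR_one scaleR_scaleR) (simp add: algebra_simps)
    qed
    have m: "(\<lambda>v. f (x, v)) \<in> borel_measurable (\<Pi>\<^sub>M i\<in>(UNIV :: 'm set). lborel)"
      "(\<lambda>v. ennreal (c ^ CARD('n)) * f (kick h i (x, v))) \<in> borel_measurable (\<Pi>\<^sub>M i\<in>(UNIV :: 'm set). lborel)"
      by measurable
    have k: "kick h i (x, v) = (x, v(i := T v (v i)))" for v
      by (simp add: kick_def T_def)
    show "(\<integral>\<^sup>+v. ennreal ((1 - h * rate i x) ^ CARD('n)) * f (kick h i (x, v)) \<partial>(\<Pi>\<^sub>M i\<in>(UNIV :: 'm set). lborel))
        = (\<integral>\<^sup>+v. f (x, v) \<partial>(\<Pi>\<^sub>M i\<in>(UNIV :: 'm set). lborel))"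
      unfolding c_def[symmetric] k
    proof (rule nn_integral_PiM_component[where c = "\<lambda>_. ennreal (c ^ CARD('n))" and f = "\<lambda>v. f (x, v)"])
      fix v :: "'m \<Rightarrow> real ^ 'n" and g :: "real ^ 'n \<Rightarrow> ennreal"
      assume "g \<in> borel_measurable lborel"
      then show "(\<integral>\<^sup>+y. ennreal (c ^ CARD('n)) * g (T (v(i := y)) y) \<partial>lborel) = (\<integral>\<^sup>+y. g y \<partial>lborel)"
        using nn_integral_lborel_affine[OF _ c, of g "b v"] by (simp add: T)
    qed (use m k in \<open>auto intro: lborel.sigma_finite_measure_axioms\<close>)
  qed
  also have "\<dots> = (\<integral>\<^sup>+z. f z \<partial>phase)"
    by (rule V.nn_integral_fst) measurable
  finally show ?thesis .
qed

lemma weight_nonneg: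
  fixes a :: "nat \<Rightarrow> 'm::finite"
  assumes "0 \<le> h" "h * \<phi> 0 < 1"
  shows "0 \<le> weight h a k z"
proof (induction k)
  case (Suc k)
  have "h * rate i x \<le> h * \<phi> 0" for i :: 'm and x :: "'m \<Rightarrow> 'n torus"
    using assms rate_le by (intro mult_left_mono) auto
  then have "h * rate i x \<le> 1" for i :: 'm and x :: "'m \<Rightarrow> 'n torus"
    using assms(2) by (meson less_imp_le order_trans)
  then show ?case using Suc by simp
qed simp

text \<open>The area formula for the discrete flow. The induction leaves \<open>f\<close> arbitrary:
  the last drift and kick, with the Jacobian of the kick, are absorbed into the test function, the
  hypothesis removes the earlier steps, and the two elementary substitutions remove the last
  one.\<close>

theorem nn_integral_weight_traj:
  fixes f :: "('m::finite \<Rightarrow> 'n torus) \<times> ('m \<Rightarrow> real ^ 'n) \<Rightarrow> ennreal"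
  assumes "f \<in> borel_measurable phase" and h: "0 \<le> h" "h * \<phi> 0 < 1"
  shows "(\<integral>\<^sup>+z. ennreal (weight h a k z) * f (traj h a k z) \<partial>phase) = (\<integral>\<^sup>+z. f z \<partial>phase)"
  using assms(1)
proof (induction k arbitrary: f)
  case 0
  then show ?case by simp
next
  case (Suc k)
  note [measurable] = Suc.prems
  define F where "F z = ennreal ((1 - h * rate (a k) (fst z)) ^ CARD('n)) * f (kick h (a k) z)"
    for z :: "('m \<Rightarrow> 'n torus) \<times> ('m \<Rightarrow> real ^ 'n)"
  have [measurable]: "F \<in> borel_measurable phase"
    unfolding F_def by measurable
  have "(\<integral>\<^sup>+z. ennreal (weight h a (Suc k) z) * f (traj h a (Suc k) z) \<partial>phase)
      = (\<integral>\<^sup>+z. ennreal (weight h a k z) * F (drift h (a k) (traj h a k z)) \<partial>phase)"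
    by (rule nn_integral_cong) (simp add: F_def ennreal_mult' weight_nonneg[OF h] mult.assoc)
  also have "\<dots> = (\<integral>\<^sup>+z. F (drift h (a k) z) \<partial>phase)"
    by (rule Suc.IH) measurable
  also have "\<dots> = (\<integral>\<^sup>+z. F z \<partial>phase)"
    by (rule nn_integral_drift) measurable
  also have "\<dots> = (\<integral>\<^sup>+z. f z \<partial>phase)"
    unfolding F_def by (rule nn_integral_kick[OF _ h]) measurable
  finally show ?case .
qed

end

section \<open>Lifting solutions to Euclidean space\<close>

lemma halfline_antiderivative:
  fixes w :: "real \<Rightarrow> 'a::euclidean_space"
  assumes "continuous_on {0..} w"
  obtains W where "W 0 = c" "\<And>t. t \<ge> 0 \<Longrightarrow> (W has_vector_derivative w t) (at t within {0..})"
proof (rule that[of "\<lambda>t. c + integral {0..t} w"])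
  fix t :: real
  assume t: "t \<ge> 0"
  have "((\<lambda>s. integral {0..s} w) has_vector_derivative w t) (at t within {0..t + 1})"
    using t by (intro integral_has_vector_derivative continuous_on_subset[OF assms]) auto
  then have "((\<lambda>s. c + integral {0..s} w) has_vector_derivative w t) (at t within {0..t + 1})"
    by (auto intro!: derivative_eq_intros)
  moreover have "at t within {0..t + 1} = at t within {0..}"
    by (rule at_within_nhd[of _ "{..<t + 1}"]) auto
  ultimately show "((\<lambda>s. c + integral {0..s} w) has_vector_derivative w t) (at t within {0..})"
    by simp
qed simp

text \<open>The hypothesis gives only local lifts, a different one near each time. The global
  candidate \<open>X\<close> is an antiderivative of \<open>w\<close>. Coordinatewise it is compared
  with \<open>rep_torus (x s)\<close>, which may jump, but only by multiples of
  \<open>2 * pi\<close>, and the cosine does not see these. Near each time the representative can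
  therefore be exchanged for the local lift, so the cosine of the difference has derivative
  \<open>0\<close> and keeps its initial value \<open>1\<close>.\<close>

lemma torus_path_lift:
  fixes x :: "real \<Rightarrow> 'n::finite torus" and w :: "real \<Rightarrow> real ^ 'n"
  assumes der: "\<And>t. t \<ge> 0 \<Longrightarrow> has_torus_derivative x (w t) t {0..}"
    and cont: "continuous_on {0..} w"
  obtains X where "\<And>t. t \<ge> 0 \<Longrightarrow> (X has_vector_derivative w t) (at t within {0..})"
    "\<And>t. t \<ge> 0 \<Longrightarrow> to_torus (X t) = x t"
proof -
  obtain X where X_0: "X 0 = rep_torus (x 0)"
    and X: "\<And>t. t \<ge> 0 \<Longrightarrow> (X has_vector_derivative w t) (at t within {0..})"
    using halfline_antiderivative[OF cont] by blast
  have "to_torus (X t) = x t" if t: "t \<ge> 0" for t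
  proof -
    have "\<exists>k::int. rep_torus (x t) $ c - X t $ c = 2 * pi * of_int k" for c
    proof -
      define g where "g s = cos (rep_torus (x s) $ c - X s $ c)" for s
      have g0: "(g has_real_derivative 0) (at s within {0..})" if s: "s \<in> {0..}" for s
      proof -
        obtain y e where e: "e > 0" and y: "\<And>r. r \<in> insert s {0..} \<Longrightarrow> dist r s < e \<Longrightarrow> to_torus (y r) = x r"
          and dy: "(y has_vector_derivative w s) (at s within {0..})"
          using der[of s] s unfolding has_torus_derivative_def by auto
        have "((\<lambda>r. y r - X r) has_vector_derivative 0) (at s within {0..})"
          using has_vector_derivative_diff[OF dy X] s by simp
        then have "((\<lambda>r. (y r - X r) $ c) has_vector_derivative 0 $ c) (at s within {0..})"
          by (rule bounded_linear.has_vector_derivative[OF bounded_linear_vec_nth])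
        then have "((\<lambda>r. y r $ c - X r $ c) has_real_derivative 0) (at s within {0..})"
          by (simp add: has_real_derivative_iff_has_vector_derivative)
        from DERIV_chain2[OF DERIV_cos this]
        have "((\<lambda>r. cos (y r $ c - X r $ c)) has_real_derivative 0) (at s within {0..})"
          by simp
        then show ?thesis
        proof (rule has_field_derivative_transform_within[OF _ e s])
          fix r assume r: "r \<in> {0..}" "dist r s < e"
          have "to_torus (y r) = to_torus (rep_torus (x r))"
            using y[of r] r by simp
          then obtain k :: int where "y r $ c - rep_torus (x r) $ c = 2 * pi * of_int k"
            unfolding to_torus_eq_iff torus_rel_def by blast
          then have "y r $ c - X r $ c = (rep_torus (x r) $ c - X r $ c) + 2 * pi * of_int k"
            by (simp add: algebra_simps)
          then show "cos (y r $ c - X r $ c) = g r"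
            by (simp only: g_def cos_add cos_int_2pin sin_int_2pin mult_1_right mult_zero_right diff_zero)
        qed
      qed
      obtain C where C: "\<And>s. s \<in> {0..} \<Longrightarrow> g s = C"
        using has_field_derivative_zero_constant[OF _ g0] by auto
      have "g t = g 0" using C t by simp
      also have "\<dots> = 1" by (simp add: g_def X_0)
      finally obtain k :: int where "rep_torus (x t) $ c - X t $ c = of_int k * 2 * pi"
        unfolding g_def cos_one_2pi_int by blast
      then show ?thesis by (intro exI[of _ k]) (simp add: mult_ac)
    qed
    then have "torus_rel (rep_torus (x t)) (X t)"
      by (simp add: torus_rel_def)
    then show ?thesis
      by (metis to_torus_eq_iff to_torus_rep)
  qed
  then show ?thesis using that X by blast
qed

context local_kernel
begin

text \<open>The derivative of the lifted kernel is lattice periodic, so its bound on the compact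
  closed cube is a global one.\<close>

lemma kernel_lipschitz:
  obtains L where "L \<ge> 0" "\<And>a b. \<bar>\<phi> (to_torus a) - \<phi> (to_torus b)\<bar> \<le> L * norm (a - b)"
proof -
  obtain D :: "real ^ 'n \<Rightarrow> (real ^ 'n) \<Rightarrow>\<^sub>L real" where D: "continuous_on UNIV D"
    "\<And>y. ((\<lambda>z. \<phi> (to_torus z)) has_derivative blinfun_apply (D y)) (at y)"
    using kernel_derivative by blast
  have per: "D (y + l) = D y" if "l \<in> torus_lattice" for y l
  proof -
    have "((\<lambda>z. \<phi> (to_torus (z + l))) has_derivative blinfun_apply (D (y + l))) (at y)"
      by (rule has_derivative_compose[OF _ D(2), of "\<lambda>z. z + l" "\<lambda>z. z", simplified]) 
         (auto intro!: derivative_eq_intros)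
    then have "((\<lambda>z. \<phi> (to_torus z)) has_derivative blinfun_apply (D (y + l))) (at y)"
      using that by (simp add: to_torus_add_lattice)
    then show ?thesis
      using D(2)[of y] by (metis blinfun_apply_inject has_derivative_unique)
  qed
  have "compact (D ` cbox 0 (\<chi> i. 2 * pi))"
    by (intro compact_continuous_image continuous_on_subset[OF D(1)]) auto
  then obtain L where L: "\<And>y. y \<in> cbox 0 (\<chi> i. 2 * pi) \<Longrightarrow> norm (D y) \<le> L"
    by (meson bounded_iff compact_imp_bounded imageI)
  have DL: "norm (D y) \<le> L" for y
  proof -
    obtain l where l: "l \<in> torus_lattice" "y - l \<in> torus_cube"
      using torus_cube_translate[of y] by blast
    have "y - l \<in> cbox 0 (\<chi> i. 2 * pi)"
      using l(2) by (auto simp: torus_cube_def mem_box_cart less_imp_le)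
    then show ?thesis
      using L[of "y - l"] per[OF l(1), of "y - l"] by simp
  qed
  have "norm (\<phi> (to_torus a) - \<phi> (to_torus b)) \<le> L * norm (a - b)" for a b
  proof (rule differentiable_bound[of UNIV])
    show "onorm (blinfun_apply (D y)) \<le> L" for y
      using DL[of y] by (simp add: norm_blinfun.rep_eq)
  qed (use D(2) in auto)
  moreover have "L \<ge> 0" using DL[of 0] norm_ge_zero order_trans by blast
  ultimately show ?thesis using that by simp
qed

definition lifted_solution :: "(real \<Rightarrow> 'm::finite \<Rightarrow> real ^ 'n) \<Rightarrow> (real \<Rightarrow> 'm \<Rightarrow> real ^ 'n) \<Rightarrow> bool" where
  "lifted_solution X V \<longleftrightarrow> (\<forall>t\<ge>0. \<forall>i.
     ((\<lambda>s. X s i) has_vector_derivative V t i) (at t within {0..}) \<and>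
     ((\<lambda>s. V s i) has_vector_derivative
        (1 / real CARD('m)) *\<^sub>R (\<Sum>j\<in>UNIV. \<phi> (to_torus (X t i - X t j)) *\<^sub>R (V t j - V t i)))
       (at t within {0..}))"

lemma alignment_solution_lift:
  fixes x :: "real \<Rightarrow> 'm::finite \<Rightarrow> 'n torus"
  assumes sol: "alignment_solution \<phi> x0 v0 x v"
  obtains X where "lifted_solution X v" "\<And>t i. t \<ge> 0 \<Longrightarrow> to_torus (X t i) = x t i"
proof -
  have "\<exists>Y. (\<forall>t\<ge>0. (Y has_vector_derivative v t i) (at t within {0..})) \<and> (\<forall>t\<ge>0. to_torus (Y t) = x t i)" for i
  proof -
    have "continuous_on {0..} (\<lambda>t. v t i)"
      using sol unfolding alignment_solution_def
      by (intro continuous_on_vector_derivative) auto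
    then show ?thesis
      using torus_path_lift[of "\<lambda>s. x s i" "\<lambda>s. v s i"] sol unfolding alignment_solution_def by metis
  qed
  then obtain Y where Y: "\<And>i t. t \<ge> 0 \<Longrightarrow> (Y i has_vector_derivative v t i) (at t within {0..})"
    "\<And>i t. t \<ge> 0 \<Longrightarrow> to_torus (Y i t) = x t i"
    by metis
  have "lifted_solution (\<lambda>t i. Y i t) v"
    using sol Y unfolding lifted_solution_def alignment_solution_def by (simp add: to_torus_diff)
  then show ?thesis using that[of "\<lambda>t i. Y i t"] Y(2) by simp
qed

lemma lifted_solutionD:
  fixes X V :: "real \<Rightarrow> 'm::finite \<Rightarrow> real ^ 'n"
  assumes "lifted_solution X V" "t \<ge> 0"
  shows "((\<lambda>s. X s i) has_vector_derivative V t i) (at t within {0..})"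
    "((\<lambda>s. V s i) has_vector_derivative
        (1 / real CARD('m)) *\<^sub>R (\<Sum>j\<in>UNIV. \<phi> (to_torus (X t i - X t j)) *\<^sub>R (V t j - V t i)))
       (at t within {0..})"
  using assms unfolding lifted_solution_def by auto

lemma lifted_solution_continuous:
  assumes "lifted_solution X V"
  shows "continuous_on {0..} (\<lambda>s. X s i)" "continuous_on {0..} (\<lambda>s. V s i)"
  using lifted_solutionD[OF assms] by (auto intro!: continuous_on_vector_derivative)

end

section \<open>Local error of the scheme\<close>

text \<open>The mean value inequality with a general majorant \<open>g\<close>, through which
  integrals of rates enter later as their antiderivatives. Derivatives at \<open>0\<close> are
  one-sided; the inequality uses derivatives in the open interval and continuity at its
  ends.\<close>

lemma halfline_increment_bound:
  fixes f :: "real \<Rightarrow> 'a::real_normed_vector" and g :: "real \<Rightarrow> real"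
  assumes st: "0 \<le> s" "s \<le> t"
    and f: "\<And>r. s \<le> r \<Longrightarrow> r \<le> t \<Longrightarrow> (f has_vector_derivative f' r) (at r within {0..})"
    and g: "\<And>r. s \<le> r \<Longrightarrow> r \<le> t \<Longrightarrow> (g has_vector_derivative g' r) (at r within {0..})"
    and le: "\<And>r. s \<le> r \<Longrightarrow> r \<le> t \<Longrightarrow> norm (f' r) \<le> g' r"
  shows "norm (f t - f s) \<le> g t - g s"
proof (cases "s = t")
  case False
  have sub: "{s..t} \<subseteq> {0..}" using st by auto
  show ?thesis
  proof (rule differentiable_bound_general[where f' = f' and \<phi>' = g'])
    show "s < t" using False st by simp
    show "continuous_on {s..t} f"
      by (intro continuous_on_vector_derivative[where f' = f'] has_vector_derivative_within_subset[OF f sub]) auto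
    show "continuous_on {s..t} g"
      by (intro continuous_on_vector_derivative[where f' = g'] has_vector_derivative_within_subset[OF g sub]) auto
    fix r assume r: "s < r" "r < t"
    have "at r within {0..} = at r"
      using r st by (intro at_within_open_subset[of _ "{0<..}"]) auto
    then show "(f has_vector_derivative f' r) (at r)" "(g has_vector_derivative g' r) (at r)"
      using f[of r] g[of r] r by simp_all
    show "norm (f' r) \<le> g' r" using le[of r] r by simp
  qed
qed simp

lemma halfline_lipschitz:
  fixes f :: "real \<Rightarrow> 'a::real_normed_vector"
  assumes "0 \<le> s" "s \<le> t"
    and "\<And>r. s \<le> r \<Longrightarrow> r \<le> t \<Longrightarrow> (f has_vector_derivative f' r) (at r within {0..})"
    and "\<And>r. s \<le> r \<Longrightarrow> r \<le> t \<Longrightarrow> norm (f' r) \<le> B"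
  shows "norm (f t - f s) \<le> B * (t - s)"
proof -
  have "norm (f t - f s) \<le> B * t - B * s"
    by (rule halfline_increment_bound[where f' = f' and g' = "\<lambda>_. B"])
       (use assms in \<open>auto intro!: derivative_eq_intros\<close>)
  then show ?thesis by (simp add: algebra_simps)
qed

lemma norm_scaleR_diff_le:
  fixes u w :: "'a::real_normed_vector"
  assumes "0 \<le> p" "p \<le> P" "\<bar>p - q\<bar> \<le> d" "norm (u - w) \<le> e" "norm w \<le> B"
  shows "norm (p *\<^sub>R u - q *\<^sub>R w) \<le> P * e + d * B"
proof -
  have "p *\<^sub>R u - q *\<^sub>R w = p *\<^sub>R (u - w) + (p - q) *\<^sub>R w"
    by (simp add: algebra_simps)
  then have "norm (p *\<^sub>R u - q *\<^sub>R w) \<le> p * norm (u - w) + \<bar>p - q\<bar> * norm w"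
    using norm_triangle_ineq[of "p *\<^sub>R (u - w)" "(p - q) *\<^sub>R w"] assms(1) by simp
  also have "\<dots> \<le> P * e + d * B"
    using assms by (intro add_mono mult_mono) auto
  finally show ?thesis .
qed

lemma norm_average_le:
  fixes g :: "'m::finite \<Rightarrow> 'b::real_normed_vector"
  assumes "\<And>j. norm (g j) \<le> B"
  shows "norm ((1 / real CARD('m)) *\<^sub>R (\<Sum>j\<in>UNIV. g j)) \<le> B"
  using sum_norm_bound[of UNIV g B] assms by (simp add: divide_le_eq mult.commute)

lemma linear_combination_le:
  fixes d h A B C' :: real
  assumes "0 \<le> d" "0 \<le> h" "A \<le> C'" "B \<le> C'"
  shows "A * d + B * h \<le> C' * (d + h)"
  using mult_right_mono[OF assms(3,1)] mult_right_mono[OF assms(4,2)] by (simp add: algebra_simps)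

text \<open>The velocity bound is required only up to \<open>T\<close>, where compactness supplies
  some \<open>R\<close>. The bound by the initial speeds for all times,
  \<open>velocity_le_initial\<close>, is itself a consequence of the convergence proved under this
  weaker assumption.\<close>

locale bounded_solution = local_kernel \<phi> r0 for \<phi> :: "'n::finite torus \<Rightarrow> real" and r0 +
  fixes X V :: "real \<Rightarrow> 'm::finite \<Rightarrow> real ^ 'n" and L R T :: real
  assumes sol: "lifted_solution X V"
    and L: "0 \<le> L" and lip: "\<bar>\<phi> (to_torus a) - \<phi> (to_torus b)\<bar> \<le> L * norm (a - b)"
    and R: "0 \<le> R" and velocity_bound: "0 \<le> t \<Longrightarrow> t \<le> T \<Longrightarrow> norm (V t i) \<le> R"
begin

abbreviation "P \<equiv> \<phi> 0"

lemma P_nonneg: "0 \<le> P"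
  by (rule kernel_nonneg)

definition force :: "real \<Rightarrow> 'm \<Rightarrow> real ^ 'n" where
  "force t i = (1 / real CARD('m)) *\<^sub>R (\<Sum>j\<in>UNIV. \<phi> (to_torus (X t i - X t j)) *\<^sub>R (V t j - V t i))"

lemma X_deriv: "0 \<le> t \<Longrightarrow> ((\<lambda>s. X s i) has_vector_derivative V t i) (at t within {0..})"
  by (rule lifted_solutionD[OF sol])

lemma V_deriv: "0 \<le> t \<Longrightarrow> ((\<lambda>s. V s i) has_vector_derivative force t i) (at t within {0..})"
  unfolding force_def by (rule lifted_solutionD[OF sol])

lemma velocity_diff_bound: "0 \<le> t \<Longrightarrow> t \<le> T \<Longrightarrow> norm (V t j - V t i) \<le> 2 * R"
  using norm_triangle_ineq4[of "V t j" "V t i"] velocity_bound[of t i] velocity_bound[of t j] by simp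

lemma force_bound:
  assumes "0 \<le> t" "t \<le> T"
  shows "norm (force t i) \<le> 2 * P * R"
  unfolding force_def
proof (rule norm_average_le)
  fix j
  have "norm (\<phi> (to_torus (X t i - X t j)) *\<^sub>R (V t j - V t i)) \<le> P * (2 * R)"
    unfolding norm_scaleR
    using velocity_diff_bound[OF assms] kernel_le kernel_nonneg by (intro mult_mono) auto
  then show "norm (\<phi> (to_torus (X t i - X t j)) *\<^sub>R (V t j - V t i)) \<le> 2 * P * R" by simp
qed

lemma X_lipschitz:
  assumes "0 \<le> s" "s \<le> t" "t \<le> T"
  shows "norm (X t i - X s i) \<le> R * (t - s)"
  by (rule halfline_lipschitz[where f' = "\<lambda>r. V r i"]) (use assms X_deriv velocity_bound in auto)

lemma V_lipschitz:
  assumes "0 \<le> s" "s \<le> t" "t \<le> T"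
  shows "norm (V t i - V s i) \<le> 2 * P * R * (t - s)"
  by (rule halfline_lipschitz[where f' = "\<lambda>r. force r i"]) (use assms V_deriv force_bound in auto)

lemma kernel_along_lipschitz:
  assumes "0 \<le> s" "s \<le> t" "t \<le> T"
  shows "\<bar>\<phi> (to_torus (X t i - X t j)) - \<phi> (to_torus (X s i - X s j))\<bar> \<le> L * (2 * R * (t - s))"
proof -
  have "norm ((X t i - X t j) - (X s i - X s j)) \<le> norm (X t i - X s i) + norm (X t j - X s j)"
    using norm_triangle_ineq4[of "X t i - X s i" "X t j - X s j"] by (simp add: algebra_simps)
  also have "\<dots> \<le> 2 * R * (t - s)"
    using X_lipschitz[OF assms, of i] X_lipschitz[OF assms, of j] by simp
  finally show ?thesis
    using lip[of "X t i - X t j" "X s i - X s j"] L by (meson mult_left_mono order_trans)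
qed

lemma force_lipschitz:
  assumes "0 \<le> s" "s \<le> t" "t \<le> T"
  shows "norm (force t i - force s i) \<le> (4 * P\<^sup>2 * R + 4 * L * R\<^sup>2) * (t - s)"
proof -
  have "force t i - force s i = (1 / real CARD('m)) *\<^sub>R (\<Sum>j\<in>UNIV.
      \<phi> (to_torus (X t i - X t j)) *\<^sub>R (V t j - V t i) - \<phi> (to_torus (X s i - X s j)) *\<^sub>R (V s j - V s i))"
    by (simp add: force_def sum_subtractf scaleR_diff_right)
  also have "norm \<dots> \<le> P * (4 * P * R * (t - s)) + L * (2 * R * (t - s)) * (2 * R)"
  proof (intro norm_average_le norm_scaleR_diff_le kernel_nonneg kernel_le kernel_along_lipschitz assms
      velocity_diff_bound)
    fix j
    have "norm ((V t j - V t i) - (V s j - V s i)) \<le> norm (V t j - V s j) + norm (V t i - V s i)"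
      using norm_triangle_ineq4[of "V t j - V s j" "V t i - V s i"] by (simp add: algebra_simps)
    then show "norm ((V t j - V t i) - (V s j - V s i)) \<le> 4 * P * R * (t - s)"
      using V_lipschitz[OF assms, of i] V_lipschitz[OF assms, of j] by simp
  qed (use assms in auto)
  finally show ?thesis
    by (simp add: algebra_simps power2_eq_square)
qed

text \<open>The first-order inequality is applied to \<open>X r - r *\<^sub>R V s\<close>, whose
  derivative is itself of order \<open>h\<close>; this yields the error of order
  \<open>h * h\<close>. \<open>V_taylor\<close> works in the same way.\<close>

lemma X_taylor:
  assumes "0 \<le> s" "0 \<le> h" "s + h \<le> T"
  shows "norm (X (s + h) i - X s i - h *\<^sub>R V s i) \<le> 2 * P * R * h * h"
proof -
  have "norm ((X (s + h) i - (s + h) *\<^sub>R V s i) - (X s i - s *\<^sub>R V s i)) \<le> (2 * P * R * h) * (s + h - s)"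
  proof (rule halfline_lipschitz[where f' = "\<lambda>r. V r i - V s i"])
    fix r assume r: "s \<le> r" "r \<le> s + h"
    show "((\<lambda>r. X r i - r *\<^sub>R V s i) has_vector_derivative V r i - V s i) (at r within {0..})"
      using r assms by (auto intro!: derivative_eq_intros X_deriv)
    have "norm (V r i - V s i) \<le> 2 * P * R * (r - s)"
      using r assms by (intro V_lipschitz) auto
    also have "\<dots> \<le> 2 * P * R * h"
      using r assms R P_nonneg by (intro mult_left_mono) auto
    finally show "norm (V r i - V s i) \<le> 2 * P * R * h" .
  qed (use assms in auto)
  then show ?thesis by (simp add: algebra_simps)
qed

lemma V_taylor:
  assumes "0 \<le> s" "0 \<le> h" "s + h \<le> T"
  shows "norm (V (s + h) i - V s i - h *\<^sub>R force s i) \<le> (4 * P\<^sup>2 * R + 4 * L * R\<^sup>2) * h * h"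
proof -
  have "norm ((V (s + h) i - (s + h) *\<^sub>R force s i) - (V s i - s *\<^sub>R force s i))
      \<le> ((4 * P\<^sup>2 * R + 4 * L * R\<^sup>2) * h) * (s + h - s)"
  proof (rule halfline_lipschitz[where f' = "\<lambda>r. force r i - force s i"])
    fix r assume r: "s \<le> r" "r \<le> s + h"
    show "((\<lambda>r. V r i - r *\<^sub>R force s i) has_vector_derivative force r i - force s i) (at r within {0..})"
      using r assms by (auto intro!: derivative_eq_intros V_deriv)
    have "norm (force r i - force s i) \<le> (4 * P\<^sup>2 * R + 4 * L * R\<^sup>2) * (r - s)"
      using r assms by (intro force_lipschitz) auto
    also have "\<dots> \<le> (4 * P\<^sup>2 * R + 4 * L * R\<^sup>2) * h"
      using r assms R L P_nonneg by (intro mult_left_mono) auto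
    finally show "norm (force r i - force s i) \<le> (4 * P\<^sup>2 * R + 4 * L * R\<^sup>2) * h" .
  qed (use assms in auto)
  then show ?thesis by (simp add: algebra_simps)
qed

text \<open>Dominates the coefficients of all the one-step error estimates.\<close>

definition C :: real where
  "C = 1 + 2 * P * R + 3 * L + 2 * L * R + 2 * P + 6 * R * L + 2 * P\<^sup>2 * R + 4 * R\<^sup>2 * L
     + 4 * P\<^sup>2 * R + 4 * L * R\<^sup>2"

lemma C_pos: "0 < C"
  unfolding C_def using R L P_nonneg by (intro add_pos_nonneg) auto

definition shifted :: "real \<Rightarrow> 'm \<Rightarrow> ('m \<Rightarrow> real ^ 'n) \<Rightarrow> ('m \<Rightarrow> real ^ 'n) \<Rightarrow> real ^ 'n" where
  "shifted h i Y w = Y i + h *\<^sub>R w i"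

text \<open>One step of the scheme, with asynchronous agents: agent \<open>j\<close> approximates
  the solution at its own clock \<open>\<tau> j\<close>, and all clocks lie within \<open>h\<close>
  of each other. The agent \<open>i\<close> to be moved is one that lags behind, at time
  \<open>s\<close>, and is advanced to \<open>s + h\<close>. In a bound
  \<open>\<delta> + C * h * (\<delta> + h)\<close> the part with \<open>\<delta>\<close> is
  propagated error and \<open>C * h * h\<close> is new error.\<close>

context
  fixes s h \<delta> :: real and \<tau> :: "'m \<Rightarrow> real" and i :: 'm and Y w :: "'m \<Rightarrow> real ^ 'n"
  assumes s: "0 \<le> s" "s + h \<le> T" and h: "0 \<le> h" "h \<le> 1"
    and \<tau>: "\<And>j. s \<le> \<tau> j" "\<And>j. \<tau> j \<le> s + h" "\<tau> i = s"
    and \<delta>: "0 \<le> \<delta>"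
    and Y: "\<And>j. norm (Y j - X (\<tau> j) j) \<le> \<delta>"
    and w: "\<And>j. norm (w j - V (\<tau> j) j) \<le> \<delta>"
begin

lemma step_position: "norm (shifted h i Y w - X (s + h) i) \<le> \<delta> + C * h * (\<delta> + h)"
proof -
  have "shifted h i Y w - X (s + h) i = (Y i - X s i) + h *\<^sub>R (w i - V s i) - (X (s + h) i - X s i - h *\<^sub>R V s i)"
    by (simp add: shifted_def algebra_simps)
  also have "norm \<dots> \<le> norm (Y i - X s i) + norm (h *\<^sub>R (w i - V s i)) + norm (X (s + h) i - X s i - h *\<^sub>R V s i)"
    by (meson norm_triangle_ineq norm_triangle_ineq4 add_right_mono order_trans)
  also have "\<dots> \<le> \<delta> + h * \<delta> + 2 * P * R * h * h"
    using Y[of i] w[of i] \<tau>(3) h X_taylor[OF s(1) h(1) s(2), of i]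
    by (intro add_mono) (auto intro: mult_left_mono)
  also have "\<dots> = \<delta> + h * (1 * \<delta> + (2 * P * R) * h)"
    by (simp add: algebra_simps)
  also have "\<dots> \<le> \<delta> + h * (C * (\<delta> + h))"
    using h \<delta> R L P_nonneg by (intro add_left_mono mult_left_mono linear_combination_le) (auto simp: C_def)
  finally show ?thesis by (simp add: algebra_simps)
qed

text \<open>Origin of the constants: two position errors give \<open>2 * \<delta>\<close>, the drift
  of \<open>i\<close> gives at most \<open>\<delta> + R * h\<close> since \<open>h \<le> 1\<close>,
  and the mismatch between the clock of \<open>j\<close> and \<open>s\<close> gives another
  \<open>R * h\<close>.\<close>

lemma step_kernel:
  assumes "j \<noteq> i"
  shows "\<bar>\<phi> (to_torus (shifted h i Y w - Y j)) - \<phi> (to_torus (X s i - X s j))\<bar> \<le> L * (3 * \<delta> + 2 * R * h)"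
proof -
  have sT: "s \<le> T" "\<tau> j \<le> T" using s h \<tau>(2)[of j] by linarith+
  have "norm (w i) \<le> \<delta> + R"
    using norm_triangle_sub[of "w i" "V s i"] w[of i] \<tau>(3) velocity_bound[OF s(1) sT(1), of i] by simp
  then have "h * norm (w i) \<le> h * (\<delta> + R)"
    using h by (intro mult_left_mono) auto
  also have "\<dots> \<le> \<delta> + R * h"
    using h \<delta> mult_right_mono[of h 1 \<delta>] by (simp add: algebra_simps)
  finally have 1: "norm (h *\<^sub>R w i) \<le> \<delta> + R * h" using h by simp
  have 2: "norm (X (\<tau> j) j - X s j) \<le> R * h"
    using X_lipschitz[OF s(1) \<tau>(1)[of j] sT(2), of j] mult_left_mono[of "\<tau> j - s" h R] \<tau>(2)[of j] R
    by simp
  have "(shifted h i Y w - Y j) - (X s i - X s j) = ((Y i - X s i) + h *\<^sub>R w i) - ((Y j - X (\<tau> j) j) + (X (\<tau> j) j - X s j))"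
    by (simp add: shifted_def algebra_simps)
  also have "norm \<dots> \<le> (norm (Y i - X s i) + norm (h *\<^sub>R w i)) + (norm (Y j - X (\<tau> j) j) + norm (X (\<tau> j) j - X s j))"
    by (intro order_trans[OF norm_triangle_ineq4] add_mono norm_triangle_ineq)
  also have "\<dots> \<le> 3 * \<delta> + 2 * R * h"
    using 1 2 Y[of i] Y[of j] \<tau>(3) by simp
  finally show ?thesis
    using lip[of "shifted h i Y w - Y j" "X s i - X s j"] L by (meson mult_left_mono order_trans)
qed

lemma step_velocity:
  assumes wi: "wi = w i + (h / real CARD('m)) *\<^sub>R
    (\<Sum>j\<in>UNIV. \<phi> (to_torus (shifted h i Y w - (Y(i := shifted h i Y w)) j)) *\<^sub>R (w j - w i))"
  shows "norm (wi - V (s + h) i) \<le> \<delta> + C * h * (\<delta> + h)"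
proof -
  define G where "G = (1 / real CARD('m)) *\<^sub>R (\<Sum>j\<in>UNIV. \<phi> (to_torus (shifted h i Y w - (Y(i := shifted h i Y w)) j)) *\<^sub>R (w j - w i))"
  have sT: "s \<le> T" using s h by linarith
  have "G - force s i = (1 / real CARD('m)) *\<^sub>R (\<Sum>j\<in>UNIV. \<phi> (to_torus (shifted h i Y w - (Y(i := shifted h i Y w)) j)) *\<^sub>R (w j - w i)
      - \<phi> (to_torus (X s i - X s j)) *\<^sub>R (V s j - V s i))"
    by (simp add: G_def force_def sum_subtractf scaleR_diff_right)
  also have "norm \<dots> \<le> P * (2 * \<delta> + 2 * P * R * h) + L * (3 * \<delta> + 2 * R * h) * (2 * R)"
  proof (rule norm_average_le)
    fix j
    show "norm (\<phi> (to_torus (shifted h i Y w - (Y(i := shifted h i Y w)) j)) *\<^sub>R (w j - w i) - \<phi> (to_torus (X s i - X s j)) *\<^sub>R (V s j - V s i))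
        \<le> P * (2 * \<delta> + 2 * P * R * h) + L * (3 * \<delta> + 2 * R * h) * (2 * R)"
    proof (cases "j = i")
      case True
      then show ?thesis using P_nonneg L R \<delta> h by simp
    next
      case False
      have "\<tau> j \<le> T" using s \<tau>(2)[of j] by linarith
      from V_lipschitz[OF s(1) \<tau>(1)[of j] this, of j]
      have "norm (V (\<tau> j) j - V s j) \<le> 2 * P * R * h"
        using mult_left_mono[of "\<tau> j - s" h "2 * P * R"] \<tau>(2)[of j] R P_nonneg by simp
      moreover have "norm ((w j - w i) - (V s j - V s i))
          \<le> norm (w j - V (\<tau> j) j) + norm (V (\<tau> j) j - V s j) + norm (w i - V s i)"
        using norm_triangle_ineq4[of "(w j - V (\<tau> j) j) + (V (\<tau> j) j - V s j)" "w i - V s i"]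
          norm_triangle_ineq[of "w j - V (\<tau> j) j" "V (\<tau> j) j - V s j"] by (simp add: algebra_simps)
      ultimately have "norm ((w j - w i) - (V s j - V s i)) \<le> 2 * \<delta> + 2 * P * R * h"
        using w[of i] w[of j] \<tau>(3) by simp
      then show ?thesis
        using False step_kernel[OF False] velocity_diff_bound[OF s(1) sT]
        by (intro norm_scaleR_diff_le kernel_nonneg kernel_le) auto
    qed
  qed
  also have "\<dots> = (2 * P + 6 * R * L) * \<delta> + (2 * P\<^sup>2 * R + 4 * R\<^sup>2 * L) * h"
    by (simp add: algebra_simps power2_eq_square)
  finally have G: "norm (G - force s i) \<le> (2 * P + 6 * R * L) * \<delta> + (2 * P\<^sup>2 * R + 4 * R\<^sup>2 * L) * h" .
  \<comment> \<open>Propagated error, error in the force, and Taylor remainder of the exact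
    solution.\<close>
  have "wi - V (s + h) i = (w i - V s i) + h *\<^sub>R (G - force s i) - (V (s + h) i - V s i - h *\<^sub>R force s i)"
    by (simp add: wi G_def algebra_simps)
  also have "norm \<dots> \<le> norm (w i - V s i) + norm (h *\<^sub>R (G - force s i)) + norm (V (s + h) i - V s i - h *\<^sub>R force s i)"
    by (meson norm_triangle_ineq norm_triangle_ineq4 add_right_mono order_trans)
  also have "\<dots> \<le> \<delta> + h * ((2 * P + 6 * R * L) * \<delta> + (2 * P\<^sup>2 * R + 4 * R\<^sup>2 * L) * h)
      + (4 * P\<^sup>2 * R + 4 * L * R\<^sup>2) * h * h"
    using w[of i] \<tau>(3) h V_taylor[OF s(1) h(1) s(2), of i] mult_left_mono[OF G h(1)]
    by (intro add_mono) auto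
  also have "\<dots> = \<delta> + h * ((2 * P + 6 * R * L) * \<delta> + (2 * P\<^sup>2 * R + 4 * R\<^sup>2 * L + (4 * P\<^sup>2 * R + 4 * L * R\<^sup>2)) * h)"
    by (simp add: algebra_simps)
  also have "\<dots> \<le> \<delta> + h * (C * (\<delta> + h))"
    using h \<delta> R L P_nonneg by (intro add_left_mono mult_left_mono linear_combination_le) (auto simp: C_def)
  finally show ?thesis by (simp add: algebra_simps)
qed

text \<open>An upper bound suffices, since it serves to bound the weight from below. One copy of
  \<open>C * h * (\<delta> + h)\<close> pays for evaluating the rate at approximate, asynchronous
  positions, the other for freezing the exact rate at time \<open>s\<close> instead of integrating
  it.\<close>

lemma step_rate:
  assumes I: "\<And>t. 0 \<le> t \<Longrightarrow> (I has_vector_derivative rate i (\<lambda>j. to_torus (X t j))) (at t within {0..})"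
  shows "h * rate i (\<lambda>j. to_torus ((Y(i := shifted h i Y w)) j)) \<le> I (s + h) - I s + 2 * C * h * (\<delta> + h)"
proof -
  have card: "real (card (UNIV - {i})) \<le> real CARD('m)" by (simp add: card_Diff_subset)
  have avg: "(\<Sum>j\<in>UNIV - {i}. f j) / real CARD('m) \<le> (\<Sum>j\<in>UNIV - {i}. g j) / real CARD('m) + B"
    if "\<And>j. j \<noteq> i \<Longrightarrow> f j \<le> g j + B" "0 \<le> B" for f g :: "'m \<Rightarrow> real" and B
  proof -
    have "(\<Sum>j\<in>UNIV - {i}. f j) \<le> (\<Sum>j\<in>UNIV - {i}. g j + B)"
      using that by (intro sum_mono) auto
    also have "\<dots> \<le> (\<Sum>j\<in>UNIV - {i}. g j) + real CARD('m) * B"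
      using mult_right_mono[OF card that(2)] by (simp add: sum.distrib)
    finally show ?thesis by (simp add: field_simps)
  qed
  define \<rho> where "\<rho> t = rate i (\<lambda>j. to_torus (X t j))" for t
  have "rate i (\<lambda>j. to_torus ((Y(i := shifted h i Y w)) j)) \<le> \<rho> s + L * (3 * \<delta> + 2 * R * h)"
    unfolding rate_def \<rho>_def
  proof (rule avg)
    show "\<phi> (to_torus ((Y(i := shifted h i Y w)) i) - to_torus ((Y(i := shifted h i Y w)) j))
        \<le> \<phi> (to_torus (X s i) - to_torus (X s j)) + L * (3 * \<delta> + 2 * R * h)" if "j \<noteq> i" for j
      using step_kernel[OF that] that by (simp add: to_torus_diff)
  qed (use L R \<delta> h in simp)
  also have "L * (3 * \<delta> + 2 * R * h) = (3 * L) * \<delta> + (2 * L * R) * h"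
    by (simp add: algebra_simps)
  also have "\<rho> s + \<dots> \<le> \<rho> s + C * (\<delta> + h)"
    using h \<delta> R L P_nonneg by (intro add_left_mono linear_combination_le) (auto simp: C_def)
  finally have 1: "rate i (\<lambda>j. to_torus ((Y(i := shifted h i Y w)) j)) \<le> \<rho> s + C * (\<delta> + h)" .
  have 2: "\<rho> s \<le> \<rho> r + C * h" if r: "s \<le> r" "r \<le> s + h" for r
  proof -
    have "\<rho> s \<le> \<rho> r + L * (2 * R * h)"
      unfolding rate_def \<rho>_def
    proof (rule avg)
      fix j assume "j \<noteq> i"
      have "L * (2 * R * (r - s)) \<le> L * (2 * R * h)"
        using r L R by (intro mult_left_mono) auto
      then show "\<phi> (to_torus (X s i) - to_torus (X s j)) \<le> \<phi> (to_torus (X r i) - to_torus (X r j)) + L * (2 * R * h)"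
        using kernel_along_lipschitz[of s r i j] r s by (simp add: to_torus_diff)
    qed (use L R \<delta> h in simp)
    also have "L * (2 * R * h) \<le> C * h"
      using mult_right_mono[of "2 * L * R" C h] h R L P_nonneg by (simp add: C_def)
    finally show ?thesis by simp
  qed
  have "norm ((s + h) * \<rho> s - s * \<rho> s) \<le> (I (s + h) + C * h * (s + h)) - (I s + C * h * s)"
  proof (rule halfline_increment_bound[where f' = "\<lambda>_. \<rho> s" and g' = "\<lambda>r. \<rho> r + C * h"])
    fix r assume r: "s \<le> r" "r \<le> s + h"
    show "((\<lambda>r. r * \<rho> s) has_vector_derivative \<rho> s) (at r within {0..})"
      by (auto intro!: derivative_eq_intros)
    show "((\<lambda>r. I r + C * h * r) has_vector_derivative \<rho> r + C * h) (at r within {0..})"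
      using r s I[of r] unfolding \<rho>_def by (auto intro!: derivative_eq_intros)
    show "norm (\<rho> s) \<le> \<rho> r + C * h" using 2[OF r] rate_nonneg[of i "\<lambda>j. to_torus (X s j)"] by (simp add: \<rho>_def)
  qed (use s h in auto)
  then have 3: "h * \<rho> s \<le> I (s + h) - I s + C * h * h"
    by (simp add: algebra_simps)
  have "h * rate i (\<lambda>j. to_torus ((Y(i := shifted h i Y w)) j)) \<le> h * (\<rho> s + C * (\<delta> + h))"
    using 1 h by (intro mult_left_mono) auto
  also have "\<dots> \<le> I (s + h) - I s + C * h * h + C * h * (\<delta> + h)"
    using 3 by (simp add: algebra_simps)
  also have "C * h * h \<le> C * h * (\<delta> + h)"
    using C_pos h \<delta> by (intro mult_left_mono) auto
  finally show ?thesis by (simp add: algebra_simps)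
qed

end

end

section \<open>Convergence of the scheme\<close>

text \<open>Step \<open>k\<close> updates agent \<open>a k\<close>; \<open>cnt k i\<close> is the number of updates of agent \<open>i\<close> before step \<open>k\<close>.\<close>

definition round_robin :: "(nat \<Rightarrow> 'm::finite) \<Rightarrow> (nat \<Rightarrow> 'm \<Rightarrow> nat) \<Rightarrow> bool" where
  "round_robin a cnt \<longleftrightarrow>
     (\<forall>i. cnt 0 i = 0) \<and>
     (\<forall>k i. cnt (Suc k) i = (if i = a k then Suc (cnt k i) else cnt k i)) \<and>
     (\<forall>k j. cnt k (a k) \<le> cnt k j) \<and>
     (\<forall>k j. cnt k j \<le> Suc (cnt k (a k))) \<and>
     (\<forall>m i. cnt (m * CARD('m)) i = m)"

lemma round_robin_exists:
  obtains a :: "nat \<Rightarrow> 'm::finite" and cnt where "round_robin a cnt"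
proof -
  obtain e :: "'m \<Rightarrow> nat" where e: "bij_betw e UNIV {0..<CARD('m)}"
    using ex_bij_betw_finite_nat[OF finite, of UNIV] by blast
  define a where "a k = inv_into UNIV e (k mod CARD('m))" for k
  define cnt where "cnt k i = k div CARD('m) + (if e i < k mod CARD('m) then 1 else 0)" for k i
  have N: "0 < CARD('m)" by simp
  have ea: "e (a k) = k mod CARD('m)" for k
    using bij_betw_inv_into_right[OF e, of "k mod CARD('m)"] N by (simp add: a_def)
  have inj: "i = a k \<longleftrightarrow> e i = k mod CARD('m)" for i k
    using bij_betw_imp_inj_on[OF e] ea[of k] by (metis UNIV_I inj_onD)
  have lt: "e i < CARD('m)" for i
    using bij_betwE[OF e] by auto
  have "cnt (Suc k) i = (if i = a k then Suc (cnt k i) else cnt k i)" for k i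
    using lt[of i] N unfolding inj cnt_def by (auto simp: div_Suc mod_Suc)
  moreover have "cnt k (a k) \<le> cnt k j" "cnt k j \<le> Suc (cnt k (a k))" for k j
    by (auto simp: cnt_def ea)
  ultimately have "round_robin a cnt"
    by (simp add: round_robin_def) (simp add: cnt_def)
  then show ?thesis by (rule that)
qed

text \<open>Turns the product of Jacobian factors into the exponential of a sum. The
  \<open>2\<close> in front of the rates in later exponents comes from here.\<close>

lemma exp_le_one_minus:
  fixes u :: real
  assumes "0 \<le> u" "u \<le> 1 / 2"
  shows "exp (- (2 * u)) \<le> 1 - u"
proof -
  have "u * u \<le> 1 / 2 * u" using assms by (intro mult_right_mono) auto
  then have "- (2 * u) \<le> ln (1 - u)"
    using ln_one_minus_pos_lower_bound[OF assms] by (simp add: power2_eq_square)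
  then have "exp (- (2 * u)) \<le> exp (ln (1 - u))" by simp
  then show ?thesis using assms by simp
qed

context bounded_solution
begin

definition initial :: "('m \<Rightarrow> 'n torus) \<times> ('m \<Rightarrow> real ^ 'n)" where
  "initial = (\<lambda>i. to_torus (X 0 i), V 0)"

context
  fixes a :: "nat \<Rightarrow> 'm" and cnt :: "nat \<Rightarrow> 'm \<Rightarrow> nat" and I :: "'m \<Rightarrow> real \<Rightarrow> real"
  assumes rr: "round_robin a cnt"
    and I: "\<And>i t. 0 \<le> t \<Longrightarrow> (I i has_vector_derivative rate i (\<lambda>j. to_torus (X t j))) (at t within {0..})"
    and I_0: "\<And>i. I i 0 = 0"
begin

lemma cnt_0: "cnt 0 i = 0"
  and cnt_Suc: "cnt (Suc k) i = (if i = a k then Suc (cnt k i) else cnt k i)"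
  and cnt_ge: "cnt k (a k) \<le> cnt k i"
  and cnt_le: "cnt k i \<le> Suc (cnt k (a k))"
  and cnt_round: "cnt (m * CARD('m)) i = m"
  using rr unfolding round_robin_def by blast+

text \<open>\<open>\<delta>\<close> is the exact solution of
  \<open>\<delta> (Suc k) = \<delta> k + C * h * (\<delta> k + h)\<close> with
  \<open>\<delta> 0 = 0\<close>; equivalently \<open>\<delta> k + h\<close> grows by the factor
  \<open>1 + C * h\<close> per step. \<open>E\<close> majorizes this growth over the whole run.
  Positions are compared through Euclidean lifts \<open>Y\<close>, so that norms of differences make
  sense.\<close>

lemma traj_error:
  assumes h: "0 \<le> h" "h \<le> 1" "h * P \<le> 1 / 2" and m: "h * real m \<le> T" and k: "k \<le> m * CARD('m)"
  defines "\<delta> \<equiv> \<lambda>k. h * ((1 + C * h) ^ k - 1)"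
  defines "E \<equiv> (1 + C * h) ^ (m * CARD('m))"
  shows "(\<exists>Y. (\<forall>i. fst (traj h a k initial) i = to_torus (Y i)) \<and>
             (\<forall>i. norm (Y i - X (h * cnt k i) i) \<le> \<delta> k)) \<and>
     (\<forall>i. norm (snd (traj h a k initial) i - V (h * cnt k i) i) \<le> \<delta> k) \<and>
     exp (- (2 * real CARD('n) * ((\<Sum>i\<in>UNIV. I i (h * cnt k i)) + 2 * C * h * real k * (h * E))))
       \<le> weight h a k initial"
  using k
proof (induction k)
  case 0
  show ?case
    by (auto simp: initial_def cnt_0 I_0 \<delta>_def intro!: exI[of _ "X 0"])
next
  case (Suc k)
  define z where "z = traj h a k initial"
  define w where "w = snd z"
  define i where "i = a k"
  define s where "s = h * cnt k i"
  define \<tau> where "\<tau> j = h * cnt k j" for j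
  have Ch: "0 \<le> C * h" using C_pos h by simp
  obtain Y where Yz: "\<And>j. fst z j = to_torus (Y j)" and Y: "\<And>j. norm (Y j - X (\<tau> j) j) \<le> \<delta> k"
    and w: "\<And>j. norm (w j - V (\<tau> j) j) \<le> \<delta> k"
    and W: "exp (- (2 * real CARD('n) * ((\<Sum>i\<in>UNIV. I i (\<tau> i)) + 2 * C * h * real k * (h * E)))) \<le> weight h a k initial"
    using Suc unfolding z_def w_def \<tau>_def by auto
  \<comment> \<open>Counters only grow and all equal \<open>m\<close> at the end, so no clock runs
    past the interval on which the velocities are bounded.\<close>
  have cnt_mono: "cnt (Suc k) j \<le> m" for j
  proof -
    have "cnt p j \<le> cnt (Suc p) j" for p by (simp add: cnt_Suc)
    then have "cnt (Suc k) j \<le> cnt (m * CARD('m)) j"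
      using Suc.prems by (rule lift_Suc_mono_le)
    then show ?thesis by (simp add: cnt_round)
  qed
  have sh: "s + h = h * cnt (Suc k) i" by (simp add: s_def i_def cnt_Suc algebra_simps)
  have s: "0 \<le> s" "s + h \<le> T"
  proof -
    show "0 \<le> s" using h by (simp add: s_def)
    have "h * cnt (Suc k) i \<le> h * real m"
      using cnt_mono h by (intro mult_left_mono) auto
    then show "s + h \<le> T" using m sh by simp
  qed
  \<comment> \<open>The agent whose turn it is has the least counter, and no counter is more than
    one ahead of it.\<close>
  have \<tau>: "s \<le> \<tau> j" "\<tau> j \<le> s + h" "\<tau> i = s" for j
  proof -
    show "s \<le> \<tau> j" unfolding s_def \<tau>_def i_def using h cnt_ge[of k j] by (intro mult_left_mono) auto
    have "\<tau> j \<le> h * real (Suc (cnt k (a k)))"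
      unfolding \<tau>_def using h cnt_le[of k j] by (intro mult_left_mono) auto
    then show "\<tau> j \<le> s + h" by (simp add: s_def i_def algebra_simps)
    show "\<tau> i = s" by (simp add: \<tau>_def s_def)
  qed
  have pow: "1 \<le> (1 + C * h) ^ k" using Ch by (simp add: one_le_power)
  then have \<delta>: "0 \<le> \<delta> k" using h by (simp add: \<delta>_def)
  have \<delta>_Suc: "\<delta> (Suc k) = \<delta> k + C * h * (\<delta> k + h)"
    by (simp add: \<delta>_def algebra_simps)
  have \<delta>_mono: "\<delta> k \<le> \<delta> (Suc k)"
    using Ch \<delta> h by (simp add: \<delta>_Suc)
  define Y' where "Y' = Y(i := shifted h i Y w)"
  have d: "fst (drift h i z) = (\<lambda>j. to_torus (Y' j))" "snd (drift h i z) = w"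
    by (auto simp: drift_def Y'_def shifted_def Yz w_def to_torus_add fun_eq_iff)
  define wi where "wi = w i + (h / real CARD('m)) *\<^sub>R
    (\<Sum>j\<in>UNIV. \<phi> (to_torus (shifted h i Y w - (Y(i := shifted h i Y w)) j)) *\<^sub>R (w j - w i))"
  have z': "traj h a (Suc k) initial = (\<lambda>j. to_torus (Y' j), w(i := wi))"
    by (simp add: kick_def d z_def[symmetric] i_def[symmetric] wi_def to_torus_diff)
       (simp add: Y'_def)
  note ctx = s h(1,2) \<tau> \<delta> Y w
  have pos: "norm (shifted h i Y w - X (s + h) i) \<le> \<delta> (Suc k)"
    unfolding \<delta>_Suc by (rule step_position[where \<tau> = \<tau>, OF ctx])
  have vel: "norm (wi - V (s + h) i) \<le> \<delta> (Suc k)"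
    unfolding \<delta>_Suc by (rule step_velocity[where \<tau> = \<tau>, OF ctx wi_def])
  have old: "h * cnt (Suc k) j = \<tau> j" if "j \<noteq> i" for j
    using that by (simp add: \<tau>_def cnt_Suc i_def)
  have Y': "norm (Y' j - X (h * cnt (Suc k) j) j) \<le> \<delta> (Suc k)" for j
    using pos Y[of j] \<delta>_mono old[of j] sh by (cases "j = i") (auto simp: Y'_def)
  have w': "norm ((w(i := wi)) j - V (h * cnt (Suc k) j) j) \<le> \<delta> (Suc k)" for j
    using vel w[of j] \<delta>_mono old[of j] sh by (cases "j = i") auto
  define u where "u = h * rate i (\<lambda>j. to_torus (Y' j))"
  have u: "0 \<le> u" "u \<le> 1 / 2"
  proof -
    show "0 \<le> u" using h by (simp add: u_def rate_nonneg)
    have "u \<le> h * P" unfolding u_def using h by (intro mult_left_mono rate_le) auto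
    then show "u \<le> 1 / 2" using h by simp
  qed
  have "u \<le> I i (s + h) - I i s + 2 * C * h * (\<delta> k + h)"
    unfolding u_def Y'_def by (rule step_rate[where \<tau> = \<tau>, OF ctx I])
  also have "\<delta> k + h = h * (1 + C * h) ^ k" by (simp add: \<delta>_def algebra_simps)
  also have "2 * C * h * (h * (1 + C * h) ^ k) \<le> 2 * C * h * (h * E)"
    unfolding E_def using Ch h C_pos Suc.prems by (intro mult_left_mono power_increasing) auto
  finally have ub: "u \<le> I i (s + h) - I i s + 2 * C * h * (h * E)" by simp
  \<comment> \<open>Only the clock of \<open>i\<close> advances, so one increment of
    \<open>I i\<close> is added; the exponent telescopes even though the agents stand at different
    times.\<close>
  have sumI: "(\<Sum>j\<in>UNIV. I j (h * cnt (Suc k) j)) = (\<Sum>j\<in>UNIV. I j (\<tau> j)) + (I i (s + h) - I i s)"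
  proof -
    have "(\<Sum>j\<in>UNIV. I j (h * cnt (Suc k) j)) = I i (s + h) + (\<Sum>j\<in>UNIV - {i}. I j (h * cnt (Suc k) j))"
      unfolding sh by (rule sum.remove) auto
    also have "(\<Sum>j\<in>UNIV - {i}. I j (h * cnt (Suc k) j)) = (\<Sum>j\<in>UNIV - {i}. I j (\<tau> j))"
      by (rule sum.cong) (auto simp: old)
    also have "\<dots> = (\<Sum>j\<in>UNIV. I j (\<tau> j)) - I i s"
      using sum.remove[of UNIV i "\<lambda>j. I j (\<tau> j)"] \<tau>(3) by simp
    finally show ?thesis by simp
  qed
  let ?n = "real CARD('n)"
  define b where "b = (\<Sum>i\<in>UNIV. I i (\<tau> i)) + 2 * C * h * real k * (h * E)"
  have "(\<Sum>j\<in>UNIV. I j (h * cnt (Suc k) j)) + 2 * C * h * real (Suc k) * (h * E)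
      = b + (I i (s + h) - I i s + 2 * C * h * (h * E))"
    by (simp add: sumI b_def algebra_simps)
  then have "b + u \<le> (\<Sum>j\<in>UNIV. I j (h * cnt (Suc k) j)) + 2 * C * h * real (Suc k) * (h * E)"
    using ub by simp
  then have "2 * ?n * (b + u) \<le> 2 * ?n * ((\<Sum>j\<in>UNIV. I j (h * cnt (Suc k) j)) + 2 * C * h * real (Suc k) * (h * E))"
    by (intro mult_left_mono) auto
  then have "exp (- (2 * ?n * ((\<Sum>j\<in>UNIV. I j (h * cnt (Suc k) j)) + 2 * C * h * real (Suc k) * (h * E))))
      \<le> exp (- (2 * ?n * (b + u)))"
    by simp
  also have "\<dots> = exp (- (2 * ?n * b)) * exp (- (2 * u)) ^ CARD('n)"
    by (simp add: exp_of_nat_mult[symmetric] exp_add[symmetric] algebra_simps)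
  also have "\<dots> \<le> weight h a k initial * (1 - u) ^ CARD('n)"
    using W exp_le_one_minus[OF u] unfolding b_def[symmetric]
    by (intro mult_mono power_mono) (auto intro: order_trans[OF exp_ge_zero])
  also have "\<dots> = weight h a (Suc k) initial"
    by (simp add: u_def d z_def[symmetric] i_def[symmetric])
  finally show ?case
    unfolding z' using Y' w' by (intro conjI exI[of _ Y']) auto
qed

text \<open>After \<open>m\<close> full rounds with step \<open>T / m\<close> every clock shows
  exactly \<open>T\<close>. The \<open>- 1\<close> in the exponent is room for the accumulated error
  of the rates, which is at most \<open>T / m * D\<close> with \<open>D\<close> independent of
  \<open>m\<close>.\<close>

theorem scheme_converges:
  assumes T: "0 < T"
  shows "(\<lambda>m. snd (traj (T / real m) a (m * CARD('m)) initial) i) \<longlonglongrightarrow> V T i"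
    and "\<forall>\<^sub>F m in sequentially. exp (- (2 * real CARD('n) * (\<Sum>i\<in>UNIV. I i T)) - 1)
           \<le> weight (T / real m) a (m * CARD('m)) initial"
proof -
  define E where "E = exp (C * T * real CARD('m))"
  define D where "D = 2 * real CARD('n) * (2 * C * T * real CARD('m) * E)"
  have h0: "(\<lambda>m. T / real m) \<longlonglongrightarrow> 0"
    by (rule lim_const_over_n)
  have hE: "(\<lambda>m. T / real m * E) \<longlonglongrightarrow> 0"
    using tendsto_mult_left_zero[OF h0] .
  have hD: "(\<lambda>m. T / real m * D) \<longlonglongrightarrow> 0"
    using tendsto_mult_left_zero[OF h0] .
  have hP: "(\<lambda>m. T / real m * P) \<longlonglongrightarrow> 0"
    using tendsto_mult_left_zero[OF h0] .
  \<comment> \<open>\<open>m > 0\<close> excludes the convention \<open>T / 0 = 0\<close>. The bound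
    on \<open>T / real m * P\<close> is what \<open>exp_le_one_minus\<close> needs, and the last one
    keeps the error in the exponent below the slack.\<close>
  have "\<forall>\<^sub>F m in sequentially. m > 0 \<and> T / real m < 1 \<and> T / real m * P < 1 / 2 \<and> T / real m * D < 1"
    using order_tendstoD(2)[OF h0, of 1] order_tendstoD(2)[OF hP, of "1 / 2"]
      order_tendstoD(2)[OF hD, of 1] eventually_gt_at_top[of 0]
    by (intro eventually_conj) auto
  then have ev: "\<forall>\<^sub>F m in sequentially.
      norm (snd (traj (T / real m) a (m * CARD('m)) initial) i - V T i) \<le> T / real m * E \<and>
      exp (- (2 * real CARD('n) * (\<Sum>i\<in>UNIV. I i T)) - 1) \<le> weight (T / real m) a (m * CARD('m)) initial"
  proof (eventually_elim)
    case (elim m)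
    define h where "h = T / real m"
    have h: "0 \<le> h" "h \<le> 1" "h * P \<le> 1 / 2" "h * real m = T" "0 \<le> C * h"
      using elim T C_pos by (auto simp: h_def)
    note err = traj_error[OF h(1-3) eq_refl[OF h(4)] order_refl, unfolded cnt_round h(4)]
    have "(1 + C * h) ^ (m * CARD('m)) \<le> exp (C * h) ^ (m * CARD('m))"
      using h by (intro power_mono exp_ge_add_one_self) auto
    also have "\<dots> = exp (real (m * CARD('m)) * (C * h))"
      by (rule exp_of_nat_mult[symmetric])
    also have "real (m * CARD('m)) * (C * h) = C * (h * real m) * real CARD('m)"
      by (simp add: algebra_simps)
    finally have E: "(1 + C * h) ^ (m * CARD('m)) \<le> E"
      unfolding h(4) E_def .
    have "norm (snd (traj h a (m * CARD('m)) initial) i - V T i) \<le> h * ((1 + C * h) ^ (m * CARD('m)) - 1)"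
      using err by blast
    also have "\<dots> \<le> h * E"
      using E h by (intro mult_left_mono) auto
    finally have 1: "norm (snd (traj h a (m * CARD('m)) initial) i - V T i) \<le> h * E" .
    \<comment> \<open>One factor \<open>h\<close> is used up by the number of steps, as
      \<open>h * real m = T\<close>; the other one survives and makes the error vanish.\<close>
    have "2 * C * h * real (m * CARD('m)) * (h * (1 + C * h) ^ (m * CARD('m)))
        \<le> 2 * C * h * real (m * CARD('m)) * (h * E)"
      using E h C_pos by (intro mult_left_mono) auto
    also have "\<dots> = 2 * C * (h * real m) * real CARD('m) * (h * E)"
      by (simp add: algebra_simps)
    finally have "2 * C * h * real (m * CARD('m)) * (h * (1 + C * h) ^ (m * CARD('m)))
        \<le> 2 * C * T * real CARD('m) * (h * E)"
      unfolding h(4) .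
    then have "2 * real CARD('n) * (2 * C * h * real (m * CARD('m)) * (h * (1 + C * h) ^ (m * CARD('m))))
        \<le> 2 * real CARD('n) * (2 * C * T * real CARD('m) * (h * E))"
      by (intro mult_left_mono) auto
    also have "\<dots> = h * D" by (simp add: D_def)
    also have "\<dots> \<le> 1" using elim unfolding h_def by linarith
    finally have "exp (- (2 * real CARD('n) * (\<Sum>i\<in>UNIV. I i T)) - 1)
        \<le> exp (- (2 * real CARD('n) * ((\<Sum>i\<in>UNIV. I i T) +
            2 * C * h * real (m * CARD('m)) * (h * (1 + C * h) ^ (m * CARD('m))))))"
      by (simp add: distrib_left)
    also have "\<dots> \<le> weight h a (m * CARD('m)) initial"
      using err by blast
    finally show ?case using 1 by (simp add: h_def)
  qed
  show "(\<lambda>m. snd (traj (T / real m) a (m * CARD('m)) initial) i) \<longlonglongrightarrow> V T i"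
  proof (rule Lim_null[THEN iffD2], rule Lim_null_comparison[OF _ hE])
    show "\<forall>\<^sub>F m in sequentially.
        norm (snd (traj (T / real m) a (m * CARD('m)) initial) i - V T i) \<le> T / real m * E"
      using ev by (rule eventually_mono) simp
  qed
  show "\<forall>\<^sub>F m in sequentially. exp (- (2 * real CARD('n) * (\<Sum>i\<in>UNIV. I i T)) - 1)
           \<le> weight (T / real m) a (m * CARD('m)) initial"
    using ev by (rule eventually_mono) simp
qed

end

end

section \<open>Solutions with finite total interaction\<close>

lemma increasing_bounded_tendsto_at_top:
  fixes J :: "real \<Rightarrow> real"
  assumes mono: "\<And>s t. 0 \<le> s \<Longrightarrow> s \<le> t \<Longrightarrow> J s \<le> J t" and bound: "\<And>t. 0 \<le> t \<Longrightarrow> J t \<le> B"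
  obtains l where "(J \<longlongrightarrow> l) at_top" "\<And>t. 0 \<le> t \<Longrightarrow> J t \<le> l"
proof -
  define l where "l = (SUP t\<in>{0..}. J t)"
  have bdd: "bdd_above (J ` {0..})"
    using bound by (auto intro!: bdd_aboveI[of _ B])
  have le: "J t \<le> l" if "0 \<le> t" for t
    unfolding l_def using that bdd by (intro cSUP_upper) auto
  have "(J \<longlongrightarrow> l) at_top"
  proof (rule order_tendstoI)
    fix c assume "c < l"
    then obtain T where T: "T \<ge> 0" "c < J T"
      unfolding l_def using less_cSUP_iff[OF _ bdd, of c] by auto
    then have "c < J t" if "t \<ge> T" for t
      using mono[of T t] that by simp
    then show "\<forall>\<^sub>F t in at_top. c < J t"
      unfolding eventually_at_top_linorder by blast
  next
    fix c assume "l < c"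
    then have "J t < c" if "t \<ge> 0" for t
      using le[OF that] by simp
    then show "\<forall>\<^sub>F t in at_top. J t < c"
      unfolding eventually_at_top_linorder by blast
  qed
  then show ?thesis using that le by blast
qed

text \<open>A curve of finite length converges, with \<open>J\<close> in the role of arc length. The
  limit is found along integer times, and the remaining length \<open>j - J t\<close> controls the
  distance to it at all times.\<close>

lemma convergent_of_increment_bound:
  fixes f :: "real \<Rightarrow> 'a::banach"
  assumes incr: "\<And>s t. 0 \<le> s \<Longrightarrow> s \<le> t \<Longrightarrow> norm (f t - f s) \<le> J t - J s" and bound: "\<And>t. 0 \<le> t \<Longrightarrow> J t \<le> B"
  obtains l where "(f \<longlongrightarrow> l) at_top"
proof -
  have "J s \<le> J t" if "0 \<le> s" "s \<le> t" for s t
    using incr[OF that] norm_ge_zero[of "f t - f s"] by linarith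
  then obtain j where j: "(J \<longlongrightarrow> j) at_top" and le: "\<And>t. 0 \<le> t \<Longrightarrow> J t \<le> j"
    using increasing_bounded_tendsto_at_top[of J B] bound by blast
  have J0: "((\<lambda>t. j - J t) \<longlongrightarrow> 0) at_top"
    using tendsto_diff[OF tendsto_const[of j] j] by simp
  have dist: "norm (f t - f s) \<le> j - J s" if "0 \<le> s" "s \<le> t" for s t
    using incr[OF that] le[of t] that by simp
  have "Cauchy (\<lambda>n. f (real n))"
  proof (rule metric_CauchyI)
    fix e :: real assume "e > 0"
    then obtain T where T: "\<And>t. t \<ge> T \<Longrightarrow> j - J t < e / 2"
      using order_tendstoD(2)[OF J0, of "e / 2"] unfolding eventually_at_top_linorder by auto
    obtain M :: nat where M: "real M \<ge> T" using real_arch_simple by blast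
    have "dist (f (real p)) (f (real M)) < e / 2" if "p \<ge> M" for p
      using dist[of "real M" "real p"] T[OF M] that by (simp add: dist_norm)
    then show "\<exists>M. \<forall>m\<ge>M. \<forall>n\<ge>M. dist (f (real m)) (f (real n)) < e"
      by (intro exI[of _ M] allI impI) (metis dist_triangle_half_l dist_commute)
  qed
  then obtain l where l: "(\<lambda>n. f (real n)) \<longlonglongrightarrow> l"
    using convergent_eq_Cauchy convergent_def by blast
  have "norm (f t - l) \<le> j - J t" if "t \<ge> 0" for t
  proof (rule tendsto_upperbound[OF _ _ sequentially_bot])
    show "(\<lambda>n. norm (f t - f (real n))) \<longlonglongrightarrow> norm (f t - l)"
      by (intro tendsto_intros l)
    obtain M :: nat where "real M \<ge> t" using real_arch_simple by blast
    then have "norm (f t - f (real n)) \<le> j - J t" if "n \<ge> M" for n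
      using dist[of t "real n"] that \<open>t \<ge> 0\<close> by (simp add: norm_minus_commute)
    then show "\<forall>\<^sub>F n in sequentially. norm (f t - f (real n)) \<le> j - J t"
      unfolding eventually_sequentially by blast
  qed
  then have "\<forall>\<^sub>F t in at_top. norm (f t - l) \<le> j - J t"
    unfolding eventually_at_top_linorder by blast
  then have "(f \<longlongrightarrow> l) at_top"
    by (rule Lim_null[THEN iffD2, OF Lim_null_comparison[OF _ J0]])
  then show ?thesis by (rule that)
qed

text \<open>Barbalat's lemma.\<close>

lemma lipschitz_integrable_tendsto_0:
  fixes f g J :: "real \<Rightarrow> real"
  assumes f_nonneg: "\<And>t. 0 \<le> t \<Longrightarrow> 0 \<le> f t"
    and lip: "\<And>s t. 0 \<le> s \<Longrightarrow> s \<le> t \<Longrightarrow> \<bar>f t - f s\<bar> \<le> M * (t - s)"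
    and J: "\<And>t. 0 \<le> t \<Longrightarrow> (J has_vector_derivative g t) (at t within {0..})"
    and fg: "\<And>t. 0 \<le> t \<Longrightarrow> f t \<le> g t"
    and bound: "\<And>t. 0 \<le> t \<Longrightarrow> J t \<le> B"
  shows "(f \<longlongrightarrow> 0) at_top"
proof (rule order_tendstoI)
  fix c :: real assume "c < 0"
  then have "\<forall>t\<ge>0. c < f t" using f_nonneg by (auto intro: less_le_trans)
  then show "\<forall>\<^sub>F t in at_top. c < f t"
    unfolding eventually_at_top_linorder by blast
next
  fix e :: real assume e: "0 < e"
  define M' where "M' = \<bar>M\<bar> + 1"
  \<comment> \<open>The time during which a function of slope at most \<open>M'\<close> starting
    above \<open>e\<close> stays above \<open>e / 2\<close>.\<close>
  define \<eta> where "\<eta> = e / (2 * M')"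
  have \<eta>: "\<eta> > 0" "M' * \<eta> = e / 2" "M' > 0" using e unfolding \<eta>_def by (auto simp: M'_def field_simps)
  have incr: "norm (t * c - s * c) \<le> J t - J s" if "0 \<le> s" "s \<le> t" "0 \<le> c" "\<And>r. s \<le> r \<Longrightarrow> r \<le> t \<Longrightarrow> c \<le> f r" for s t c
  proof (rule halfline_increment_bound[where f' = "\<lambda>_. c" and g' = g])
    fix r assume "s \<le> r" "r \<le> t"
    then show "norm c \<le> g r" using that fg[of r] by force
  qed (use that J in \<open>auto intro!: derivative_eq_intros\<close>)
  have "J s \<le> J t" if "0 \<le> s" "s \<le> t" for s t
    using incr[of s t 0] that f_nonneg by simp
  then obtain j where j: "(J \<longlongrightarrow> j) at_top" and le: "\<And>t. 0 \<le> t \<Longrightarrow> J t \<le> j"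
    using increasing_bounded_tendsto_at_top[of J B] bound by blast
  \<comment> \<open>From some time on \<open>J\<close> has less than \<open>e / 2 * \<eta>\<close>
    left to gain, which is the amount that a single value of \<open>f\<close> above \<open>e\<close>
    would force.\<close>
  have "j - e / 2 * \<eta> < j" using e \<eta> by simp
  then have "\<forall>\<^sub>F t in at_top. j - e / 2 * \<eta> < J t"
    using j by (intro order_tendstoD)
  then show "\<forall>\<^sub>F t in at_top. f t < e"
    using eventually_ge_at_top[of 0]
  proof eventually_elim
    case (elim t)
    show "f t < e"
    proof (rule ccontr)
      assume "\<not> f t < e"
      have "e / 2 \<le> f r" if "t \<le> r" "r \<le> t + \<eta>" for r
      proof -
        have "\<bar>f r - f t\<bar> \<le> M * (r - t)" using lip elim that by simp
        also have "\<dots> \<le> M' * \<eta>" using that \<eta> by (intro mult_mono) (auto simp: M'_def)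
        finally show ?thesis using \<eta> \<open>\<not> f t < e\<close> by linarith
      qed
      then have "norm ((t + \<eta>) * (e / 2) - t * (e / 2)) \<le> J (t + \<eta>) - J t"
        using elim e \<eta> by (intro incr) auto
      moreover have "(t + \<eta>) * (e / 2) - t * (e / 2) = e / 2 * \<eta>" by (simp add: algebra_simps)
      ultimately have "e / 2 * \<eta> \<le> J (t + \<eta>) - J t" by simp
      then show False using elim le[of "t + \<eta>"] \<eta> by simp
    qed
  qed
qed

section \<open>Resonance and Kronecker's theorem\<close>

definition resonant :: "('n \<Rightarrow> int) \<Rightarrow> real ^ 'n::finite \<Rightarrow> bool" where
  "resonant k w \<longleftrightarrow> (\<Sum>c\<in>UNIV. of_int (k c) * w $ c) = 0"

text \<open>Kronecker's theorem in units of \<open>2 * pi\<close>: the target is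
  \<open>- y / (2 * pi)\<close>, its integers become a lattice vector, and its time is multiplied by
  \<open>2 * pi\<close>.\<close>

lemma nonresonant_line_dense:
  fixes w y :: "real ^ 'n::finite"
  assumes nonres: "\<And>k. k \<noteq> (\<lambda>_. 0) \<Longrightarrow> \<not> resonant k w" and e: "e > 0"
  obtains t l where "l \<in> torus_lattice" "norm (y + t *\<^sub>R w - l) < e"
proof -
  obtain f :: "nat \<Rightarrow> 'n" where f: "bij_betw f {0..<CARD('n)} UNIV"
    using ex_bij_betw_nat_finite[OF finite, of UNIV] by blast
  \<comment> \<open>\<open>Kronecker_thm_1\<close> concerns independence of the set of values, so
    the coordinates must be distinct. Equality of two would be a resonance with the difference of
    two unit vectors.\<close>
  have inj: "inj (\<lambda>c. w $ c)"
  proof (rule injI, rule ccontr)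
    fix c d assume cd: "w $ c = w $ d" "c \<noteq> d"
    define k :: "'n \<Rightarrow> int" where "k = (\<lambda>b. (if b = c then 1 else 0) - (if b = d then 1 else 0))"
    have "(\<Sum>b\<in>UNIV. of_int (k b) * w $ b)
        = (\<Sum>b\<in>UNIV. (if b = c then w $ b else 0) - (if b = d then w $ b else 0))"
      by (rule sum.cong) (auto simp: k_def)
    then have "resonant k w"
      using cd(1) by (simp add: resonant_def sum_subtractf)
    moreover have "k c \<noteq> 0" using cd by (simp add: k_def)
    ultimately show False using nonres[of k] by auto
  qed
  interpret int_module: module "\<lambda>r. (*) (real_of_int r)"
    by unfold_locales (auto simp: algebra_simps)
  have indep: "int_module.independent (range (\<lambda>c. w $ c))"
    unfolding int_module.dependent_explicit
  proof clarify
    fix S u v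
    assume S: "finite S" "S \<subseteq> range (\<lambda>c. w $ c)" "(\<Sum>v\<in>S. real_of_int (u v) * v) = 0" "v \<in> S" "u v \<noteq> 0"
    \<comment> \<open>An integer relation among values becomes one among coordinates by injectivity,
      with coefficient \<open>0\<close> off \<open>S\<close>.\<close>
    define k where "k c = (if w $ c \<in> S then u (w $ c) else 0)" for c
    have "(\<Sum>v\<in>S. real_of_int (u v) * v) = (\<Sum>v\<in>range (\<lambda>c. w $ c). real_of_int (if v \<in> S then u v else 0) * v)"
      using S(2) by (intro sum.mono_neutral_cong_left) auto
    also have "\<dots> = (\<Sum>c\<in>UNIV. real_of_int (k c) * w $ c)"
      using inj by (simp add: sum.reindex k_def)
    finally have "resonant k w" using S(3) by (simp add: resonant_def)
    moreover obtain c where "v = w $ c" using S by blast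
    then have "k c \<noteq> 0" using S by (simp add: k_def)
    ultimately show False using nonres[of k] by auto
  qed
  have img: "(\<lambda>i. w $ f i) ` {..<CARD('n)} = range (\<lambda>c. w $ c)"
    using bij_betw_imp_surj_on[OF f] by (auto simp: lessThan_atLeast0 image_image[symmetric, of "\<lambda>c. w $ c" f])
  have injf: "inj_on (\<lambda>i. w $ f i) {..<CARD('n)}"
    using bij_betw_imp_inj_on[OF f] inj by (auto simp: lessThan_atLeast0 inj_on_def)
  \<comment> \<open>Chosen so that coordinatewise errors \<open>2 * pi * e'\<close> add up to
    \<open>e\<close> in the sum norm.\<close>
  define e' where "e' = e / (2 * pi * real CARD('n))"
  have e': "e' > 0" using e by (simp add: e'_def)
  obtain t h where th: "\<And>i. i < CARD('n) \<Longrightarrow> \<bar>t * w $ f i - of_int (h i) - (- (y $ f i) / (2 * pi))\<bar> < e'"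
    using Kronecker_thm_1[of "\<lambda>i. w $ f i" "CARD('n)" e' "\<lambda>i. - (y $ f i) / (2 * pi)"] indep injf e'
    unfolding img by metis
  define g where "g = inv_into {0..<CARD('n)} f"
  have g: "g c < CARD('n)" "f (g c) = c" for c
    using bij_betw_inv_into_right[OF f, of c] bij_betwE[OF bij_betw_inv_into[OF f]] by (auto simp: g_def)
  define l :: "real ^ 'n" where "l = (\<chi> c. 2 * pi * of_int (h (g c)))"
  have comp: "\<bar>(y + (2 * pi * t) *\<^sub>R w - l) $ c\<bar> < 2 * pi * e'" for c
  proof -
    have "(y + (2 * pi * t) *\<^sub>R w - l) $ c = 2 * pi * (t * w $ c - of_int (h (g c)) - (- (y $ c) / (2 * pi)))"
      by (simp add: l_def field_simps)
    then show ?thesis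
      using th[OF g(1)[of c]] by (simp add: g abs_mult)
  qed
  have "norm (y + (2 * pi * t) *\<^sub>R w - l) \<le> (\<Sum>c\<in>UNIV. \<bar>(y + (2 * pi * t) *\<^sub>R w - l) $ c\<bar>)"
    by (rule norm_le_l1_cart)
  also have "\<dots> < (\<Sum>c\<in>(UNIV :: 'n set). 2 * pi * e')"
    using comp by (intro sum_strict_mono) auto
  also have "\<dots> = e" by (simp add: e'_def)
  finally show ?thesis
    by (rule that[rotated]) (auto simp: l_def torus_lattice_def)
qed

section \<open>Finite interaction forces resonant limit velocities\<close>

context local_kernel
begin

context
  fixes X V :: "real \<Rightarrow> 'm::finite \<Rightarrow> real ^ 'n" and R B :: real and I :: "'m \<Rightarrow> real \<Rightarrow> real"
  assumes sol: "lifted_solution X V"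
    and vb: "\<And>t i. 0 \<le> t \<Longrightarrow> norm (V t i) \<le> R"
    and I: "\<And>i t. 0 \<le> t \<Longrightarrow> (I i has_vector_derivative rate i (\<lambda>j. to_torus (X t j))) (at t within {0..})"
    and I_bound: "\<And>i t. 0 \<le> t \<Longrightarrow> I i t \<le> B"
begin

lemma R_nonneg: "0 \<le> R"
  using vb[of 0] norm_ge_zero order_trans by blast

text \<open>The acceleration is at most \<open>2 * R * rate i\<close>, so the bounded function
  \<open>2 * R * I i\<close> majorizes the length of the velocity curve.\<close>

lemma velocity_converges:
  obtains l where "((\<lambda>t. V t i) \<longlongrightarrow> l) at_top"
proof (rule convergent_of_increment_bound)
  fix s t :: real assume st: "0 \<le> s" "s \<le> t"
  show "norm (V t i - V s i) \<le> 2 * R * I i t - 2 * R * I i s"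
  proof (rule halfline_increment_bound[OF st])
    fix r assume "s \<le> r" "r \<le> t"
    then have r: "0 \<le> r" using st by simp
    show "((\<lambda>s. V s i) has_vector_derivative
        (1 / real CARD('m)) *\<^sub>R (\<Sum>j\<in>UNIV. \<phi> (to_torus (X r i - X r j)) *\<^sub>R (V r j - V r i))) (at r within {0..})"
      by (rule lifted_solutionD(2)[OF sol r])
    show "((\<lambda>s. 2 * R * I i s) has_vector_derivative 2 * R * rate i (\<lambda>j. to_torus (X r j))) (at r within {0..})"
      by (rule has_vector_derivative_mult_right[OF I[OF r]])
    have "(\<Sum>j\<in>UNIV. \<phi> (to_torus (X r i - X r j)) *\<^sub>R (V r j - V r i))
        = (\<Sum>j\<in>UNIV - {i}. \<phi> (to_torus (X r i - X r j)) *\<^sub>R (V r j - V r i))"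
      by (rule sum.mono_neutral_right) auto
    also have "norm \<dots> \<le> (\<Sum>j\<in>UNIV - {i}. \<phi> (to_torus (X r i - X r j)) * (2 * R))"
    proof (rule sum_norm_le)
      fix j
      have "norm (V r j - V r i) \<le> 2 * R"
        using norm_triangle_ineq4[of "V r j" "V r i"] vb[OF r, of i] vb[OF r, of j] by simp
      then show "norm (\<phi> (to_torus (X r i - X r j)) *\<^sub>R (V r j - V r i)) \<le> \<phi> (to_torus (X r i - X r j)) * (2 * R)"
        using kernel_nonneg by (simp add: mult_left_mono)
    qed
    also have "\<dots> = 2 * R * rate i (\<lambda>j. to_torus (X r j)) * real CARD('m)"
      by (simp add: rate_def to_torus_diff sum_distrib_right[symmetric])
    finally show "norm ((1 / real CARD('m)) *\<^sub>R (\<Sum>j\<in>UNIV. \<phi> (to_torus (X r i - X r j)) *\<^sub>R (V r j - V r i)))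
        \<le> 2 * R * rate i (\<lambda>j. to_torus (X r j))"
      by (simp add: divide_le_eq)
  qed
next
  fix t :: real assume "0 \<le> t"
  then show "2 * R * I i t \<le> 2 * R * B"
    using I_bound R_nonneg by (intro mult_left_mono) auto
qed (use that in blast)

text \<open>The value is one of the nonnegative terms of \<open>real CARD('m) * rate a\<close>,
  whose antiderivative is bounded, and it is Lipschitz in time because the speeds are bounded.
  Barbalat's lemma applies.\<close>

lemma kernel_tendsto_0:
  assumes "a \<noteq> b"
  shows "((\<lambda>t. \<phi> (to_torus (X t a - X t b))) \<longlongrightarrow> 0) at_top"
proof -
  obtain L where L: "L \<ge> 0" "\<And>a b. \<bar>\<phi> (to_torus a) - \<phi> (to_torus b)\<bar> \<le> L * norm (a - b)"
    using kernel_lipschitz by blast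
  have bs: "bounded_solution \<phi> r0 X V L R T" for T
    using sol L R_nonneg vb by unfold_locales auto
  show ?thesis
  proof (rule lipschitz_integrable_tendsto_0)
    fix s t :: real assume "0 \<le> s" "s \<le> t"
    then show "\<bar>\<phi> (to_torus (X t a - X t b)) - \<phi> (to_torus (X s a - X s b))\<bar> \<le> (L * (2 * R)) * (t - s)"
      using bounded_solution.kernel_along_lipschitz[OF bs[of t], of s t a b] by (simp add: mult.assoc)
  next
    fix t :: real assume t: "0 \<le> t"
    show "((\<lambda>s. real CARD('m) * I a s) has_vector_derivative real CARD('m) * rate a (\<lambda>j. to_torus (X t j))) (at t within {0..})"
      by (rule has_vector_derivative_mult_right[OF I[OF t]])
    have "\<phi> (to_torus (X t a) - to_torus (X t b)) \<le> (\<Sum>j\<in>UNIV - {a}. \<phi> (to_torus (X t a) - to_torus (X t j)))"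
      using assms kernel_nonneg by (intro member_le_sum) auto
    then show "\<phi> (to_torus (X t a - X t b)) \<le> real CARD('m) * rate a (\<lambda>j. to_torus (X t j))"
      by (simp add: rate_def to_torus_diff)
    show "real CARD('m) * I a t \<le> real CARD('m) * B"
      using I_bound[OF t] by (intro mult_left_mono) auto
  qed (rule kernel_nonneg)
qed

text \<open>The velocities converge at no known rate, so the relative position \<open>u\<close> need
  not stay close to one line; only windows of fixed length are controlled,
  \<open>u (s + t) - u s\<close> tending to \<open>t *\<^sub>R w\<close>. Modulo the lattice the
  starting points \<open>u p\<close> accumulate at some \<open>y0\<close>. If \<open>w\<close> were
  non-resonant, the line through \<open>y0\<close> would be in the ball at some time
  \<open>t\<close>, and the kernel would have a positive limit along the shifted subsequence,
  contrary to \<open>kernel_tendsto_0\<close>.\<close>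

theorem limit_velocities_resonant:
  assumes ab: "a \<noteq> b" and va: "((\<lambda>t. V t a) \<longlongrightarrow> va) at_top" and vb': "((\<lambda>t. V t b) \<longlongrightarrow> vb) at_top"
  obtains k where "k \<noteq> (\<lambda>_. 0)" "resonant k (va - vb)"
proof (rule ccontr)
  assume "\<not> thesis"
  then have nonres: "\<And>k. k \<noteq> (\<lambda>_. 0) \<Longrightarrow> \<not> resonant k (va - vb)"
    using that by blast
  define w where "w = va - vb"
  define u where "u t = X t a - X t b" for t
  have u': "(u has_vector_derivative V t a - V t b) (at t within {0..})" if "0 \<le> t" for t
    unfolding u_def using lifted_solutionD(1)[OF sol that] by (intro has_vector_derivative_diff)
  have w: "((\<lambda>t. V t a - V t b) \<longlongrightarrow> w) at_top"
    unfolding w_def by (intro tendsto_diff va vb')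
  have shift: "((\<lambda>s. u (s + t) - u s) \<longlongrightarrow> t *\<^sub>R w) at_top" for t
  proof (rule tendstoI)
    fix e :: real assume e: "e > 0"
    define e' where "e' = e / (\<bar>t\<bar> + 1)"
    have e': "e' > 0" using e by (simp add: e'_def)
    have "e' * \<bar>t\<bar> < e' * (\<bar>t\<bar> + 1)" using e' by (intro mult_strict_left_mono) auto
    also have "\<dots> = e" by (simp add: e'_def)
    finally have e't: "e' * \<bar>t\<bar> < e" .
    obtain T where T: "\<And>r. r \<ge> T \<Longrightarrow> norm (V r a - V r b - w) \<le> e'"
      using tendstoD[OF w e'] unfolding eventually_at_top_linorder dist_norm by (metis less_imp_le)
    have incr: "norm ((u q - q *\<^sub>R w) - (u p - p *\<^sub>R w)) \<le> e' * (q - p)" if "0 \<le> p" "T \<le> p" "p \<le> q" for p q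
      by (rule halfline_lipschitz[where f' = "\<lambda>r. V r a - V r b - w"])
         (use that T in \<open>auto intro!: derivative_eq_intros u'\<close>)
    \<comment> \<open>Kronecker's theorem gives a time \<open>t\<close> of either sign; the margin
      \<open>\<bar>t\<bar>\<close> keeps both ends of the window nonnegative and beyond
      \<open>T\<close>.\<close>
    have "dist (u (s + t) - u s) (t *\<^sub>R w) < e" if s: "s \<ge> max 0 T + \<bar>t\<bar>" for s
    proof -
      have "norm ((u (s + t) - (s + t) *\<^sub>R w) - (u s - s *\<^sub>R w)) \<le> e' * \<bar>t\<bar>"
      proof (cases "t \<ge> 0")
        case True
        then show ?thesis using incr[of s "s + t"] s by simp
      next
        case False
        then show ?thesis using incr[of "s + t" s] s by (simp add: norm_minus_commute)
      qed
      also have "(u (s + t) - (s + t) *\<^sub>R w) - (u s - s *\<^sub>R w) = (u (s + t) - u s) - t *\<^sub>R w"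
        by (simp add: algebra_simps)
      finally show ?thesis using e't by (simp add: dist_norm)
    qed
    then show "\<forall>\<^sub>F s in at_top. dist (u (s + t) - u s) (t *\<^sub>R w) < e"
      unfolding eventually_at_top_linorder by blast
  qed
  have "\<exists>l. l \<in> torus_lattice \<and> u (real p) - l \<in> torus_cube" for p
    using torus_cube_translate by blast
  then obtain l where l: "\<And>p. l p \<in> torus_lattice" "\<And>p. u (real p) - l p \<in> torus_cube"
    by metis
  define y where "y p = u (real p) - l p" for p
  have "\<forall>p. y p \<in> cbox 0 (\<chi> i. 2 * pi)"
    using l(2) by (auto simp: y_def torus_cube_def mem_box_cart less_imp_le)
  from seq_compactE[OF compact_imp_seq_compact[OF compact_cbox] this]
  obtain y0 r where r: "strict_mono (r :: nat \<Rightarrow> nat)" "(y \<circ> r) \<longlonglongrightarrow> y0"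
    by metis
  obtain t l0 where tl: "l0 \<in> torus_lattice" "norm (y0 + t *\<^sub>R w - l0) < r0"
    using nonresonant_line_dense[of w r0 y0] nonres r0_pos unfolding w_def by blast
  have "\<phi> (to_torus (y0 + t *\<^sub>R w)) = \<phi> (to_torus (y0 + t *\<^sub>R w - l0))"
    using to_torus_add_lattice[OF tl(1), of "y0 + t *\<^sub>R w - l0"] by simp
  then have pos: "0 < \<phi> (to_torus (y0 + t *\<^sub>R w))"
    using kernel_pos[OF tl(2)] by simp
  have rinf: "filterlim (\<lambda>p. real (r p)) at_top sequentially"
    by (rule filterlim_compose[OF filterlim_real_sequentially filterlim_subseq[OF r(1)]])
  have "(\<lambda>p. y (r p) + (u (real (r p) + t) - u (real (r p)))) \<longlonglongrightarrow> y0 + t *\<^sub>R w"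
    using r(2) filterlim_compose[OF shift rinf] by (intro tendsto_add) (auto simp: o_def)
  then have "(\<lambda>p. \<phi> (to_torus (y (r p) + (u (real (r p) + t) - u (real (r p)))))) \<longlonglongrightarrow> \<phi> (to_torus (y0 + t *\<^sub>R w))"
    using continuous_on_kernel by (intro continuous_on_tendsto_compose[of UNIV "\<lambda>y. \<phi> (to_torus y)"]) auto
  moreover have "\<phi> (to_torus (y (r p) + (u (real (r p) + t) - u (real (r p))))) = \<phi> (to_torus (u (real (r p) + t)))" for p
    using to_torus_add_lattice[OF l(1)[of "r p"], of "u (real (r p) + t) - l (r p)"] by (simp add: y_def)
  ultimately have 1: "(\<lambda>p. \<phi> (to_torus (u (real (r p) + t)))) \<longlonglongrightarrow> \<phi> (to_torus (y0 + t *\<^sub>R w))"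
    by simp
  have "filterlim (\<lambda>p. real (r p) + t) at_top sequentially"
    using rinf by (simp add: filterlim_tendsto_add_at_top[OF tendsto_const] add.commute)
  then have 2: "(\<lambda>p. \<phi> (to_torus (u (real (r p) + t)))) \<longlonglongrightarrow> 0"
    unfolding u_def by (rule filterlim_compose[OF kernel_tendsto_0[OF ab]])
  show False using LIMSEQ_unique[OF 1 2] pos by simp
qed

end

end

section \<open>Almost every datum is non-resonant\<close>

context local_kernel
begin

text \<open>A kick replaces a velocity by a convex combination of all velocities: its total weight
  \<open>c * (\<Sum>j\<in>UNIV. p j)\<close> is at most \<open>h * \<phi> 0 \<le> 1\<close>.\<close>

lemma traj_velocity_bound:
  fixes a :: "nat \<Rightarrow> 'm::finite"
  assumes h: "0 \<le> h" "h * \<phi> 0 \<le> 1" and R: "\<And>i. norm (snd z i) \<le> R"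
  shows "norm (snd (traj h a k z) i) \<le> R"
proof (induction k arbitrary: i)
  case 0
  then show ?case using R by simp
next
  case (Suc k)
  define v where "v = snd (traj h a k z)"
  have v: "norm (v j) \<le> R" for j using Suc by (simp add: v_def)
  define x where "x = fst (drift h (a k) (traj h a k z))"
  define p where "p j = \<phi> (x (a k) - x j)" for j
  define c where "c = h / real CARD('m)"
  have c: "0 \<le> c" using h by (simp add: c_def)
  have p: "0 \<le> p j" for j by (simp add: p_def kernel_nonneg)
  have "c * (\<Sum>j\<in>UNIV. p j) \<le> c * (real CARD('m) * \<phi> 0)"
    using sum_bounded_above[of UNIV p "\<phi> 0"] c kernel_le by (intro mult_left_mono) (auto simp: p_def)
  also have "\<dots> \<le> 1" using h by (simp add: c_def)
  finally have S: "c * (\<Sum>j\<in>UNIV. p j) \<le> 1" .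
  have "norm (v (a k) + c *\<^sub>R (\<Sum>j\<in>UNIV. p j *\<^sub>R (v j - v (a k)))) \<le> R"
  proof -
    have "v (a k) + c *\<^sub>R (\<Sum>j\<in>UNIV. p j *\<^sub>R (v j - v (a k)))
        = (1 - c * (\<Sum>j\<in>UNIV. p j)) *\<^sub>R v (a k) + c *\<^sub>R (\<Sum>j\<in>UNIV. p j *\<^sub>R v j)"
      by (simp add: scaleR_diff_right scaleR_diff_left sum_subtractf scaleR_sum_left[symmetric])
    also have "norm \<dots> \<le> (1 - c * (\<Sum>j\<in>UNIV. p j)) * R + c * ((\<Sum>j\<in>UNIV. p j) * R)"
    proof (rule norm_triangle_le, rule add_mono)
      show "norm ((1 - c * (\<Sum>j\<in>UNIV. p j)) *\<^sub>R v (a k)) \<le> (1 - c * (\<Sum>j\<in>UNIV. p j)) * R"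
        using S v by (simp add: mult_left_mono)
      have "norm (\<Sum>j\<in>UNIV. p j *\<^sub>R v j) \<le> (\<Sum>j\<in>UNIV. p j * R)"
        using p v by (intro sum_norm_le) (simp add: mult_left_mono)
      then show "norm (c *\<^sub>R (\<Sum>j\<in>UNIV. p j *\<^sub>R v j)) \<le> c * ((\<Sum>j\<in>UNIV. p j) * R)"
        using c by (simp add: mult_left_mono sum_distrib_right)
    qed
    also have "\<dots> = R" by (simp add: algebra_simps)
    finally show ?thesis .
  qed
  moreover have "snd (drift h (a k) (traj h a k z)) = v"
    by (simp add: drift_def v_def)
  ultimately show ?case
    using v[of i] by (simp add: kick_def x_def p_def c_def)
qed

lemma bounded_solution_on:
  fixes X V :: "real \<Rightarrow> 'm::finite \<Rightarrow> real ^ 'n"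
  assumes sol: "lifted_solution X V"
  obtains L R where "bounded_solution \<phi> r0 X V L R T"
proof -
  obtain L where L: "L \<ge> 0" "\<And>a b. \<bar>\<phi> (to_torus a) - \<phi> (to_torus b)\<bar> \<le> L * norm (a - b)"
    using kernel_lipschitz by blast
  have "bounded ((\<lambda>t. V t i) ` {0..T})" for i
    by (intro compact_imp_bounded compact_continuous_image continuous_on_subset[OF lifted_solution_continuous(2)[OF sol]]) auto
  then have "\<exists>B. \<forall>t\<in>{0..T}. norm (V t i) \<le> B" for i
    unfolding bounded_iff by blast
  then obtain B where B: "\<And>i t. t \<in> {0..T} \<Longrightarrow> norm (V t i) \<le> B i"
    by metis
  define R where "R = (\<Sum>i\<in>UNIV. \<bar>B i\<bar>)"
  have "bounded_solution \<phi> r0 X V L R T"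
  proof unfold_locales
    fix t i assume t: "0 \<le> t" "t \<le> T"
    have "norm (V t i) \<le> \<bar>B i\<bar>" using B[of t i] t by force
    also have "\<dots> \<le> R" unfolding R_def by (intro member_le_sum) auto
    finally show "norm (V t i) \<le> R" .
  qed (use sol L in \<open>auto simp: R_def sum_nonneg\<close>)
  then show ?thesis by (rule that)
qed

lemma interaction_antiderivative:
  fixes X V :: "real \<Rightarrow> 'm::finite \<Rightarrow> real ^ 'n"
  assumes sol: "lifted_solution X V"
  obtains I where "\<And>i. I i 0 = 0"
    "\<And>i t. 0 \<le> t \<Longrightarrow> (I i has_vector_derivative rate i (\<lambda>j. to_torus (X t j))) (at t within {0..})"
proof -
  have "continuous_on {0..} (\<lambda>t. rate i (\<lambda>j. to_torus (X t j)))" for i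
    unfolding rate_def to_torus_diff[symmetric]
    by (intro continuous_intros continuous_on_compose2[OF continuous_on_kernel] lifted_solution_continuous(1)[OF sol]) auto
  then have "\<exists>I. I 0 = 0 \<and> (\<forall>t\<ge>0. (I has_vector_derivative rate i (\<lambda>j. to_torus (X t j))) (at t within {0..}))" for i
    by (rule halfline_antiderivative[where c = 0]) blast
  then show ?thesis using that by metis
qed

text \<open>The maximum principle passes from the scheme to its limit, which avoids differentiating
  a maximum of norms.\<close>

lemma velocity_le_initial:
  fixes X V :: "real \<Rightarrow> 'm::finite \<Rightarrow> real ^ 'n"
  assumes sol: "lifted_solution X V" and V0: "\<And>i. norm (V 0 i) \<le> R" and t: "0 \<le> t"
  shows "norm (V t i) \<le> R"
proof (cases "t = 0")
  case False
  then have t: "0 < t" using t by simp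
  obtain a :: "nat \<Rightarrow> 'm" and cnt where rr: "round_robin a cnt"
    by (rule round_robin_exists)
  obtain I where I: "\<And>i. I i 0 = 0"
    "\<And>i t. 0 \<le> t \<Longrightarrow> (I i has_vector_derivative rate i (\<lambda>j. to_torus (X t j))) (at t within {0..})"
    using interaction_antiderivative[OF sol] by blast
  obtain L R' where "bounded_solution \<phi> r0 X V L R' t"
    using bounded_solution_on[OF sol] by blast
  then interpret bounded_solution \<phi> r0 X V L R' t .
  have "(\<lambda>m. t / real m * \<phi> 0) \<longlonglongrightarrow> 0"
    using tendsto_mult_left_zero[OF lim_const_over_n] .
  then have "\<forall>\<^sub>F m in sequentially. t / real m * \<phi> 0 < 1"
    by (rule order_tendstoD) simp
  then have "\<forall>\<^sub>F m in sequentially. norm (snd (traj (t / real m) a (m * CARD('m)) initial) i) \<le> R"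
    by eventually_elim (rule traj_velocity_bound, use t V0 in \<open>auto simp: initial_def\<close>)
  moreover have "(\<lambda>m. norm (snd (traj (t / real m) a (m * CARD('m)) initial) i)) \<longlonglongrightarrow> norm (V t i)"
    by (intro tendsto_norm scheme_converges(1)[OF rr I(2,1) t])
  ultimately show ?thesis
    using tendsto_upperbound sequentially_bot by blast
qed (use V0 in simp)

text \<open>The cut-off at \<open>R\<close> makes the measure finite, so that it is continuous from
  above as \<open>p\<close> grows. The condition on the linear form is strict and thus survives
  small perturbations.\<close>

definition thin :: "'m::finite \<Rightarrow> 'm \<Rightarrow> ('n \<Rightarrow> int) \<Rightarrow> real \<Rightarrow> nat \<Rightarrow> (('m \<Rightarrow> 'n torus) \<times> ('m \<Rightarrow> real ^ 'n)) set" where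
  "thin a b k R p = {z \<in> space phase. (\<forall>i. norm (snd z i) \<le> R) \<and>
     \<bar>\<Sum>c\<in>UNIV. of_int (k c) * (snd z a - snd z b) $ c\<bar> < 1 / real (Suc p)}"

lemma thin_measurable [measurable]: "thin a b k R p \<in> sets phase"
  unfolding thin_def by measurable

text \<open>Positions contribute the finite mass of the torus, velocities a product of
  balls.\<close>

lemma emeasure_bounded_velocities:
  "emeasure phase {z \<in> space phase. \<forall>i :: 'm::finite. norm (snd z i :: real ^ 'n) \<le> R} < \<infinity>"
proof -
  interpret finite_measure "torus_lborel :: 'n torus measure"
    by (rule finite_measure_torus_lborel)
  interpret x: product_sigma_finite "\<lambda>_ :: 'm. torus_lborel :: 'n torus measure"
    by (simp add: product_sigma_finite_def sigma_finite_torus_lborel)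
  interpret v: product_sigma_finite "\<lambda>_ :: 'm. lborel :: (real ^ 'n) measure"
    by (simp add: product_sigma_finite_def lborel.sigma_finite_measure_axioms)
  interpret V: sigma_finite_measure "\<Pi>\<^sub>M i\<in>(UNIV :: 'm set). (lborel :: (real ^ 'n) measure)"
    by (rule sigma_finite_velocities)
  have eq: "{z \<in> space phase. \<forall>i :: 'm. norm (snd z i :: real ^ 'n) \<le> R}
      = (\<Pi>\<^sub>E i\<in>UNIV. space torus_lborel) \<times> (\<Pi>\<^sub>E i\<in>UNIV. cball 0 R)"
    by (auto simp: space_pair_measure space_PiM PiE_iff)
  have "emeasure (\<Pi>\<^sub>M i\<in>(UNIV :: 'm set). (torus_lborel :: 'n torus measure)) (\<Pi>\<^sub>E i\<in>UNIV. space torus_lborel) < \<infinity>"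
    by (subst x.emeasure_PiM) (auto simp: power_eq_top_ennreal less_top[symmetric])
  moreover have "emeasure (\<Pi>\<^sub>M i\<in>(UNIV :: 'm set). (lborel :: (real ^ 'n) measure)) (\<Pi>\<^sub>E i\<in>UNIV. cball 0 R) < \<infinity>"
    using emeasure_lborel_cball_finite[of "0 :: real ^ 'n" R]
    by (subst v.emeasure_PiM) (auto simp: power_less_top_ennreal less_top)
  moreover have "(\<Pi>\<^sub>E i\<in>UNIV. space torus_lborel) \<in> sets (\<Pi>\<^sub>M i\<in>(UNIV :: 'm set). (torus_lborel :: 'n torus measure))"
    by (rule sets_PiM_I_finite) auto
  moreover have "(\<Pi>\<^sub>E i\<in>UNIV. cball 0 R) \<in> sets (\<Pi>\<^sub>M i\<in>(UNIV :: 'm set). (lborel :: (real ^ 'n) measure))"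
    by (rule sets_PiM_I_finite) auto
  ultimately show ?thesis
    unfolding eq by (simp only: V.emeasure_pair_measure_Times infinity_ennreal_def ennreal_mult_less_top) simp
qed

text \<open>Integrate over \<open>v a\<close> first. Since \<open>a \<noteq> b\<close>, the vector
  \<open>v b\<close> stays fixed, and the condition on \<open>v a\<close> describes an affine
  hyperplane normal to the non-zero vector \<open>K\<close>.\<close>

lemma resonant_null:
  assumes k: "k \<noteq> (\<lambda>_. 0)" and ab: "a \<noteq> b"
  shows "emeasure phase {z \<in> space phase. resonant k (snd z (a :: 'm::finite) - snd z b :: real ^ 'n)} = 0"
proof -
  let ?V = "\<Pi>\<^sub>M i\<in>(UNIV :: 'm set). (lborel :: (real ^ 'n) measure)"
  let ?A = "{z \<in> space phase. resonant k (snd z a - snd z b :: real ^ 'n)}"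
  interpret v: product_sigma_finite "\<lambda>_ :: 'm. lborel :: (real ^ 'n) measure"
    by (simp add: product_sigma_finite_def lborel.sigma_finite_measure_axioms)
  interpret V: sigma_finite_measure ?V
    by (rule sigma_finite_velocities)
  define K :: "real ^ 'n" where "K = (\<chi> c. of_int (k c))"
  have K: "K \<noteq> 0" using k by (auto simp: K_def vec_eq_iff fun_eq_iff)
  have res: "resonant k w \<longleftrightarrow> K \<bullet> w = 0" for w
    by (simp add: resonant_def K_def inner_vec_def)
  have hyper: "emeasure lborel {y. resonant k (y - q)} = 0" for q :: "real ^ 'n"
  proof -
    have eq: "{y. resonant k (y - q)} = {y. K \<bullet> y = K \<bullet> q}"
      by (auto simp: res inner_diff_right)
    have "negligible {y. K \<bullet> y = K \<bullet> q}" using K by (intro negligible_hyperplane) auto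
    then have "{y. K \<bullet> y = K \<bullet> q} \<in> null_sets (completion lborel)"
      by (simp add: negligible_iff_null_sets)
    moreover have "{y. K \<bullet> y = K \<bullet> q} \<in> sets lborel"
      using closed_hyperplane by auto
    ultimately show ?thesis
      unfolding eq by (auto simp: null_sets_completion_iff)
  qed
  have [measurable]: "?A \<in> sets phase"
    unfolding resonant_def by measurable
  have velocity[measurable]: "(\<lambda>v. v i) \<in> borel_measurable ?V" for i
    using measurable_component_singleton[of i UNIV "\<lambda>_. lborel :: (real ^ 'n) measure"]
    by (simp cong: measurable_cong_sets)
  have m: "(\<lambda>v. indicator {w. resonant k w} (v a - v b)) \<in> borel_measurable ?V"
    unfolding resonant_def by measurable
  have U: "insert a (UNIV - {a}) = UNIV" by auto
  have "(\<integral>\<^sup>+v. indicator {w. resonant k w} (v a - v b) \<partial>?V)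
      = (\<integral>\<^sup>+v. (\<integral>\<^sup>+y. indicator {y. resonant k (y - v b)} y \<partial>lborel) \<partial>(\<Pi>\<^sub>M i\<in>UNIV - {a}. lborel))"
    using v.product_nn_integral_insert[of "UNIV - {a}" a "\<lambda>v. indicator {w. resonant k w} (v a - v b)"] m ab
    by (simp add: U indicator_def of_bool_def)
  also have "\<dots> = (\<integral>\<^sup>+v. 0 \<partial>(\<Pi>\<^sub>M i\<in>UNIV - {a}. (lborel :: (real ^ 'n) measure)))"
  proof (rule nn_integral_cong)
    fix v :: "'m \<Rightarrow> real ^ 'n"
    have "{y. resonant k (y - v b)} \<in> sets lborel" unfolding resonant_def by measurable
    then show "(\<integral>\<^sup>+y. indicator {y. resonant k (y - v b)} y \<partial>lborel) = 0"
      by (simp add: hyper)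
  qed
  finally have 0: "(\<integral>\<^sup>+v. indicator {w. resonant k w} (v a - v b) \<partial>?V) = 0" by simp
  have "emeasure phase ?A = (\<integral>\<^sup>+z. indicator ?A z \<partial>phase)" by simp
  also have "\<dots> = (\<integral>\<^sup>+x. (\<integral>\<^sup>+v. indicator ?A (x, v) \<partial>?V) \<partial>(\<Pi>\<^sub>M i\<in>(UNIV :: 'm set). torus_lborel))"
    by (rule V.nn_integral_fst[symmetric]) measurable
  also have "\<dots> = (\<integral>\<^sup>+x. (\<integral>\<^sup>+v. indicator {w. resonant k w} (v a - v b) \<partial>?V) \<partial>(\<Pi>\<^sub>M i\<in>(UNIV :: 'm set). (torus_lborel :: 'n torus measure)))"
    by (intro nn_integral_cong) (auto simp: indicator_def space_pair_measure)
  also have "\<dots> = 0" by (simp add: 0)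
  finally show ?thesis .
qed

lemma emeasure_thin_tendsto_0:
  assumes "k \<noteq> (\<lambda>_. 0)" "a \<noteq> b"
  shows "(\<lambda>p. emeasure phase (thin (a :: 'm::finite) b k R p)) \<longlonglongrightarrow> 0"
proof -
  have "(\<lambda>p. emeasure phase (thin a b k R p)) \<longlonglongrightarrow> emeasure phase (\<Inter>p. thin a b k R p)"
  proof (rule Lim_emeasure_decseq)
    show "decseq (thin a b k R)"
    proof (rule decseq_SucI, rule subsetI)
      fix p z assume "z \<in> thin a b k R (Suc p)"
      moreover have "1 / real (Suc (Suc p)) \<le> 1 / real (Suc p)"
        by (simp add: field_simps)
      ultimately show "z \<in> thin a b k R p"
        unfolding thin_def by (auto intro: less_le_trans)
    qed
    fix p
    have "emeasure phase (thin a b k R p) \<le> emeasure phase {z \<in> space phase. \<forall>i :: 'm. norm (snd z i :: real ^ 'n) \<le> R}"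
      by (rule emeasure_mono) (auto simp: thin_def, measurable)
    from le_less_trans[OF this emeasure_bounded_velocities]
    show "emeasure phase (thin a b k R p) \<noteq> \<infinity>" by simp
  qed auto
  moreover have "emeasure phase (\<Inter>p. thin a b k R p) = 0"
  proof (rule emeasure_eq_0[OF _ resonant_null[OF assms]])
    show "{z \<in> space phase. resonant k (snd z a - snd z b)} \<in> sets phase"
      unfolding resonant_def by measurable
    show "(\<Inter>p. thin a b k R p) \<subseteq> {z \<in> space phase. resonant k (snd z a - snd z b)}"
    proof
      fix z assume z: "z \<in> (\<Inter>p. thin a b k R p)"
      have "\<bar>\<Sum>c\<in>UNIV. of_int (k c) * (snd z a - snd z b) $ c\<bar> < inverse (real (Suc p))" for p
        using z by (auto simp: thin_def inverse_eq_divide)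
      then have "resonant k (snd z a - snd z b)"
        unfolding resonant_def using reals_Archimedean[of "\<bar>\<Sum>c\<in>UNIV. of_int (k c) * (snd z a - snd z b) $ c\<bar>"]
        by (meson less_asym zero_less_abs_iff)
      then show "z \<in> {z \<in> space phase. resonant k (snd z a - snd z b)}"
        using z by (auto simp: thin_def)
    qed
  qed
  ultimately show ?thesis by simp
qed

text \<open>A condition on the datum alone: it asks for some solution issuing from \<open>z\<close>,
  so that excluding it disposes of every solution with this datum at once. The antiderivative
  \<open>I\<close> and its bound \<open>B\<close> encode finite interaction in the form in which the
  weights are estimated.\<close>

definition resonant_datum :: "'m::finite \<Rightarrow> 'm \<Rightarrow> ('n \<Rightarrow> int) \<Rightarrow> real \<Rightarrow> ('m \<Rightarrow> 'n torus) \<times> ('m \<Rightarrow> real ^ 'n) \<Rightarrow> bool" where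
  "resonant_datum a b k R z \<longleftrightarrow> (\<exists>X V I B va vb.
     lifted_solution X V \<and> z = (\<lambda>i. to_torus (X 0 i), V 0) \<and> (\<forall>i. norm (V 0 i) \<le> R) \<and>
     (\<forall>i. I i 0 = 0) \<and>
     (\<forall>i. \<forall>t\<ge>0. (I i has_vector_derivative rate i (\<lambda>j. to_torus (X t j))) (at t within {0..})) \<and>
     (\<forall>i. \<forall>t\<ge>0. I i t \<le> B) \<and>
     ((\<lambda>t. V t a) \<longlongrightarrow> va) at_top \<and> ((\<lambda>t. V t b) \<longlongrightarrow> vb) at_top \<and> resonant k (va - vb))"

text \<open>
  Fatou's lemma for the nested limits \<open>m \<rightarrow> \<infinity>\<close> (number of rounds of the scheme), \<open>T \<rightarrow> \<infinity>\<close> (time)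
  and \<open>p \<rightarrow> \<infinity>\<close> (width of the slab around the resonant hyperplane): the limit function has integral
  \<open>0\<close> but is bounded below by a positive constant at every resonant datum.
\<close>

theorem AE_not_resonant_datum:
  fixes a b :: "'m::finite"
  assumes ab: "a \<noteq> b" and k: "k \<noteq> (\<lambda>_. 0)"
  shows "AE z in phase. \<not> resonant_datum a b k R z"
proof -
  obtain ag :: "nat \<Rightarrow> 'm" and cnt where rr: "round_robin ag cnt"
    by (rule round_robin_exists)
  \<comment> \<open>The time is \<open>Suc T\<close> because \<open>scheme_converges\<close> asks
    for a positive one. Weight times indicator is the integrand of
    \<open>nn_integral_weight_traj\<close>: for small steps the integral is the measure of the slab,
    whatever \<open>T\<close> and \<open>m\<close> are.\<close>
  define g where "g p T m z = ennreal (weight (real (Suc T) / real m) ag (m * CARD('m)) z) *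
    indicator (thin a b k R p) (traj (real (Suc T) / real m) ag (m * CARD('m)) z)" for p T m z
  define G where "G z = liminf (\<lambda>p. liminf (\<lambda>T. liminf (\<lambda>m. g p T m z)))" for z
  have [measurable]: "g p T m \<in> borel_measurable phase" for p T m
    unfolding g_def by measurable
  have step: "\<forall>\<^sub>F m in sequentially. real (Suc T) / real m * \<phi> 0 < 1" for T
  proof -
    have "(\<lambda>m. real (Suc T) / real m * \<phi> 0) \<longlonglongrightarrow> 0"
      using tendsto_mult_left_zero[OF lim_const_over_n] .
    then show ?thesis by (rule order_tendstoD) simp
  qed
  have int_g: "liminf (\<lambda>m. \<integral>\<^sup>+z. g p T m z \<partial>phase) \<le> emeasure phase (thin a b k R p)" for p T
  proof -
    have "\<forall>\<^sub>F m in sequentially. (\<integral>\<^sup>+z. g p T m z \<partial>phase) \<le> emeasure phase (thin a b k R p)"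
      using step[of T]
    proof eventually_elim
      case (elim m)
      have "(\<integral>\<^sup>+z. g p T m z \<partial>phase) = (\<integral>\<^sup>+z. indicator (thin a b k R p) z \<partial>phase)"
        unfolding g_def using elim by (intro nn_integral_weight_traj) auto
      then show ?case by simp
    qed
    then have "liminf (\<lambda>m. \<integral>\<^sup>+z. g p T m z \<partial>phase) \<le> liminf (\<lambda>m :: nat. emeasure phase (thin a b k R p))"
      by (rule Liminf_mono)
    then show ?thesis by (simp add: Liminf_const)
  qed
  have "(\<integral>\<^sup>+z. G z \<partial>phase) \<le> liminf (\<lambda>p. \<integral>\<^sup>+z. liminf (\<lambda>T. liminf (\<lambda>m. g p T m z)) \<partial>phase)"
    unfolding G_def by (rule nn_integral_liminf) measurable
  also have "\<dots> \<le> liminf (\<lambda>p. emeasure phase (thin a b k R p))"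
  proof (intro Liminf_mono always_eventually allI)
    fix p
    have "(\<integral>\<^sup>+z. liminf (\<lambda>T. liminf (\<lambda>m. g p T m z)) \<partial>phase)
        \<le> liminf (\<lambda>T. \<integral>\<^sup>+z. liminf (\<lambda>m. g p T m z) \<partial>phase)"
      by (rule nn_integral_liminf) measurable
    also have "\<dots> \<le> liminf (\<lambda>T :: nat. emeasure phase (thin a b k R p))"
    proof (intro Liminf_mono always_eventually allI)
      fix T
      have "(\<integral>\<^sup>+z. liminf (\<lambda>m. g p T m z) \<partial>phase) \<le> liminf (\<lambda>m. \<integral>\<^sup>+z. g p T m z \<partial>phase)"
        by (rule nn_integral_liminf) measurable
      also note int_g
      finally show "(\<integral>\<^sup>+z. liminf (\<lambda>m. g p T m z) \<partial>phase) \<le> emeasure phase (thin a b k R p)" .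
    qed
    finally show "(\<integral>\<^sup>+z. liminf (\<lambda>T. liminf (\<lambda>m. g p T m z)) \<partial>phase) \<le> emeasure phase (thin a b k R p)"
      by (simp add: Liminf_const)
  qed
  also have "\<dots> = 0"
    using emeasure_thin_tendsto_0[OF k ab, of R] by (rule lim_imp_Liminf[OF sequentially_bot])
  finally have "(\<integral>\<^sup>+z. G z \<partial>phase) = 0" by simp
  moreover have "G \<in> borel_measurable phase"
    unfolding G_def by measurable
  ultimately have "AE z in phase. G z = 0"
    by (simp add: nn_integral_0_iff_AE)
  then show ?thesis
  proof (rule AE_mp, intro AE_I2 impI notI)
    fix z :: "('m \<Rightarrow> 'n torus) \<times> ('m \<Rightarrow> real ^ 'n)"
    assume G0: "G z = 0" and "resonant_datum a b k R z"
    then obtain X V I B va vb where sol: "lifted_solution X V" and z: "z = (\<lambda>i. to_torus (X 0 i), V 0)"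
      and V0: "\<forall>i. norm (V 0 i) \<le> R" and I_0: "\<forall>i. I i 0 = 0"
      and I: "\<forall>i. \<forall>t\<ge>0. (I i has_vector_derivative rate i (\<lambda>j. to_torus (X t j))) (at t within {0..})"
      and B: "\<forall>i. \<forall>t\<ge>0. I i t \<le> B"
      and va: "((\<lambda>t. V t a) \<longlongrightarrow> va) at_top" and vb: "((\<lambda>t. V t b) \<longlongrightarrow> vb) at_top"
      and res: "resonant k (va - vb)"
      unfolding resonant_datum_def by blast
    \<comment> \<open>The bound of \<open>scheme_converges\<close> with the total interaction
      estimated by \<open>real CARD('m) * B\<close>, hence uniform in \<open>m\<close>,
      \<open>T\<close> and \<open>p\<close>.\<close>
    define c where "c = ennreal (exp (- (2 * real CARD('n) * (real CARD('m) * B)) - 1))"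
    define \<Lambda> where "\<Lambda> w = (\<Sum>c\<in>UNIV. of_int (k c) * w $ c)" for w :: "real ^ 'n"
    have \<Lambda>: "((\<lambda>s. \<Lambda> (f s)) \<longlongrightarrow> \<Lambda> l) F" if "(f \<longlongrightarrow> l) F" for f l and F :: "'z filter"
      unfolding \<Lambda>_def by (intro tendsto_intros that)
    have "c \<le> G z"
      unfolding G_def
    proof (rule Liminf_bounded, rule always_eventually, rule allI)
      fix p :: nat
      have "((\<lambda>t. \<bar>\<Lambda> (V t a - V t b)\<bar>) \<longlongrightarrow> \<bar>\<Lambda> (va - vb)\<bar>) at_top"
        by (intro tendsto_rabs \<Lambda> tendsto_diff va vb)
      moreover have "\<Lambda> (va - vb) = 0" using res by (simp add: resonant_def \<Lambda>_def)
      ultimately have "\<forall>\<^sub>F t in at_top. \<bar>\<Lambda> (V t a - V t b)\<bar> < 1 / real (Suc p)"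
        by (intro order_tendstoD(2)) auto
      then have "\<forall>\<^sub>F T in sequentially. \<bar>\<Lambda> (V (real (Suc T)) a - V (real (Suc T)) b)\<bar> < 1 / real (Suc p)"
        by (rule filterlim_compose[OF filterlim_real_sequentially filterlim_Suc, unfolded filterlim_iff, rule_format])
      then have "\<forall>\<^sub>F T in sequentially. c \<le> liminf (\<lambda>m. g p T m z)"
      proof eventually_elim
        case (elim T)
        let ?T = "real (Suc T)"
        obtain L R' where "bounded_solution \<phi> r0 X V L R' ?T"
          using bounded_solution_on[OF sol] by blast
        then interpret bounded_solution \<phi> r0 X V L R' ?T .
        have ini: "initial = z" by (simp add: initial_def z)
        have conv: "(\<lambda>m. snd (traj (?T / real m) ag (m * CARD('m)) z) i) \<longlonglongrightarrow> V ?T i" for i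
          unfolding ini[symmetric]
          by (rule scheme_converges(1)[OF rr, where I = I]) (use I I_0 in auto)
        have weights: "\<forall>\<^sub>F m in sequentially. exp (- (2 * real CARD('n) * (\<Sum>i\<in>UNIV. I i ?T)) - 1)
             \<le> weight (?T / real m) ag (m * CARD('m)) z"
          unfolding ini[symmetric]
          by (rule scheme_converges(2)[OF rr, where I = I]) (use I I_0 in auto)
        \<comment> \<open>The exact velocities satisfy the strict inequality of the slab at time
          \<open>?T\<close>, so by convergence the scheme satisfies it for large \<open>m\<close>.
          The closed condition on the speeds is not a matter of limits: it holds at each step by
          \<open>traj_velocity_bound\<close>.\<close>
        have "(\<lambda>m. \<bar>\<Lambda> (snd (traj (?T / real m) ag (m * CARD('m)) z) a - snd (traj (?T / real m) ag (m * CARD('m)) z) b)\<bar>)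
            \<longlonglongrightarrow> \<bar>\<Lambda> (V ?T a - V ?T b)\<bar>"
          by (intro tendsto_rabs \<Lambda> tendsto_diff conv)
        from order_tendstoD(2)[OF this elim] weights step[of T]
        have "\<forall>\<^sub>F m in sequentially. c \<le> g p T m z"
        proof eventually_elim
          case (elim m)
          define w where "w = traj (?T / real m) ag (m * CARD('m)) z"
          have "norm (snd w i) \<le> R" for i
            unfolding w_def using elim V0 by (intro traj_velocity_bound) (auto simp: z)
          moreover have "w \<in> space phase"
            by (simp add: space_pair_measure space_PiM)
          ultimately have "w \<in> thin a b k R p"
            using elim(1) by (simp add: thin_def w_def \<Lambda>_def)
          then have gw: "g p T m z = ennreal (weight (?T / real m) ag (m * CARD('m)) z)"
            by (simp add: g_def w_def)
          have "(\<Sum>i\<in>UNIV. I i ?T) \<le> real CARD('m) * B"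
            using sum_bounded_above[of UNIV "\<lambda>i. I i ?T" B] B by simp
          then have "2 * real CARD('n) * (\<Sum>i\<in>UNIV. I i ?T) \<le> 2 * real CARD('n) * (real CARD('m) * B)"
            by (intro mult_left_mono) auto
          then have "exp (- (2 * real CARD('n) * (real CARD('m) * B)) - 1)
              \<le> exp (- (2 * real CARD('n) * (\<Sum>i\<in>UNIV. I i ?T)) - 1)"
            by simp
          also note elim(2)
          finally show ?case
            unfolding gw c_def by (rule ennreal_leI)
        qed
        then show ?case by (rule Liminf_bounded)
      qed
      then show "c \<le> liminf (\<lambda>T. liminf (\<lambda>m. g p T m z))"
        by (rule Liminf_bounded)
    qed
    moreover have "c > 0" by (simp add: c_def)
    ultimately show False using G0 by simp
  qed
qed

text \<open>The sum over ordered pairs is \<open>real CARD('m)\<close> times the sum of the rates,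
  with antiderivative \<open>J\<close>. Each \<open>I i\<close> is nonnegative, hence at most
  \<open>J\<close>, which never exceeds the full integral.\<close>

lemma finite_interaction_bounded:
  fixes x :: "real \<Rightarrow> 'm::finite \<Rightarrow> 'n torus"
  assumes xX: "\<And>t i. 0 \<le> t \<Longrightarrow> to_torus (X t i) = x t i"
    and I_0: "\<And>i. I i 0 = 0"
    and I: "\<And>i t. 0 \<le> t \<Longrightarrow> (I i has_vector_derivative rate i (\<lambda>j. to_torus (X t j))) (at t within {0..})"
    and fin: "(\<integral>\<^sup>+ s\<in>{0..}. ennreal (\<Sum>(i, j) | i \<noteq> j. \<phi> (x s i - x s j)) \<partial>lborel) \<noteq> \<infinity>"
    and cont: "\<And>i. continuous_on {0..} (\<lambda>t. X t i)"
  obtains B where "\<And>i t. 0 \<le> t \<Longrightarrow> I i t \<le> B"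
proof -
  let ?F = "\<lambda>s. \<Sum>(i, j) | i \<noteq> j. \<phi> (x s i - x s j)"
  let ?M = "\<integral>\<^sup>+ s\<in>{0..}. ennreal (?F s) \<partial>lborel"
  define J where "J t = (\<Sum>i\<in>UNIV. real CARD('m) * I i t)" for t
  have F: "?F s = (\<Sum>i\<in>UNIV. real CARD('m) * rate i (\<lambda>j. to_torus (X s j)))" if "0 \<le> s" for s
  proof -
    have "{(i, j). i \<noteq> j} = Sigma UNIV (\<lambda>i :: 'm. UNIV - {i})" by auto
    then have "?F s = (\<Sum>i\<in>UNIV. \<Sum>j\<in>UNIV - {i}. \<phi> (x s i - x s j))"
      by (simp add: sum.Sigma)
    then show ?thesis using xX[OF that] by (simp add: rate_def)
  qed
  have J: "(J has_vector_derivative ?F t) (at t within {0..})" if "0 \<le> t" for t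
    unfolding J_def F[OF that]
    by (intro has_vector_derivative_sum has_vector_derivative_mult_right I[OF that])
  have F_nonneg: "0 \<le> ?F s" for s
    by (intro sum_nonneg) (auto simp: kernel_nonneg)
  have I_nonneg: "0 \<le> I i t" if "0 \<le> t" for i t
  proof -
    have "norm ((0 :: real) - 0) \<le> I i t - I i 0"
      by (rule halfline_increment_bound[where f' = "\<lambda>_. 0" and f = "\<lambda>_. 0" and s = 0 and t = t
            and g = "I i" and g' = "\<lambda>r. rate i (\<lambda>j. to_torus (X r j))"])
         (use that I in \<open>auto simp: rate_nonneg\<close>)
    then show ?thesis by (simp add: I_0)
  qed
  have "I i t \<le> enn2real ?M" if t: "0 \<le> t" for i t
  proof -
    \<comment> \<open>Extension by zero, since \<open>nn_integral_has_integral_lborel\<close>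
      compares the two integrals over the whole line.\<close>
    define F' where "F' s = (if s \<in> {0..t} then ?F s else 0)" for s
    have "(?F has_integral J t - J 0) {0..t}"
      using t by (intro fundamental_theorem_of_calculus has_vector_derivative_within_subset[OF J]) auto
    then have int: "(F' has_integral J t) UNIV"
      unfolding F'_def has_integral_restrict_UNIV by (simp add: J_def I_0)
    have "continuous_on {0..t} (\<lambda>s. \<Sum>(i, j) | i \<noteq> j. \<phi> (to_torus (X s i - X s j)))"
      unfolding split_def
      by (intro continuous_intros continuous_on_compose2[OF continuous_on_kernel] continuous_on_subset[OF cont]) auto
    then have "continuous_on {0..t} ?F"
      by (rule continuous_on_eq) (simp add: xX to_torus_diff)
    then have meas: "F' \<in> borel_measurable borel"
      unfolding F'_def by (intro borel_measurable_continuous_on_if) auto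
    have "ennreal (J t) = (\<integral>\<^sup>+s. ennreal (F' s) \<partial>lborel)"
      using nn_integral_has_integral_lborel[OF meas _ int] F_nonneg by (simp add: F'_def)
    also have "\<dots> \<le> ?M"
      by (intro nn_integral_mono) (auto simp: F'_def indicator_def)
    finally have "enn2real (ennreal (J t)) \<le> enn2real ?M"
      using fin by (intro enn2real_mono) (auto simp: less_top)
    moreover have "0 \<le> J t"
      unfolding J_def using I_nonneg[OF t] by (intro sum_nonneg) auto
    ultimately have "J t \<le> enn2real ?M" by simp
    moreover have "I i t \<le> J t"
    proof -
      have "1 * I i t \<le> real CARD('m) * I i t"
        using I_nonneg[OF t] by (intro mult_right_mono) (auto simp: Suc_le_eq)
      also have "\<dots> \<le> J t"
        unfolding J_def using I_nonneg[OF t] by (intro member_le_sum) auto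
      finally show ?thesis by simp
    qed
    ultimately show ?thesis by simp
  qed
  then show ?thesis by (rule that)
qed

end

theorem proposition3p1:
  fixes \<phi> :: "'n::finite torus \<Rightarrow> real" and r0 :: real
  assumes "CARD('m::finite) \<ge> 2"
    and "strictly_local_kernel \<phi> r0"
  shows "AE (x0, v0) in (\<Pi>\<^sub>M i\<in>(UNIV :: 'm set). torus_lborel) \<Otimes>\<^sub>M (\<Pi>\<^sub>M i\<in>(UNIV :: 'm set). lborel).
           \<forall>x v. alignment_solution \<phi> x0 v0 x v \<longrightarrow>
             (\<integral>\<^sup>+ s\<in>{0..}. ennreal (\<Sum>(i, j) | i \<noteq> j. \<phi> (x s i - x s j)) \<partial>lborel) = \<infinity>"
proof -
  interpret local_kernel \<phi> r0 by unfold_locales (rule assms(2))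
  \<comment> \<open>One pair is enough: finite total interaction makes the kernel die out for every
    pair, hence for this one.\<close>
  obtain a b :: 'm where ab: "a \<noteq> b"
    using assms(1) card_2_iff'[of "UNIV :: 'm set"] by (metis UNIV_I card_le_Suc0_iff_eq finite not_less_eq_eq numeral_2_eq_2)
  \<comment> \<open>Integer speed bounds, together with integer vectors \<open>k\<close>, leave a
    countable union of null sets.\<close>
  have "AE z in phase. k \<noteq> (\<lambda>_. 0) \<longrightarrow> \<not> resonant_datum a b k (real R) z" for k :: "'n \<Rightarrow> int" and R :: nat
    using AE_not_resonant_datum[OF ab, of k "real R"] by (cases "k = (\<lambda>_. 0)") auto
  then have "AE z in phase. \<forall>k. \<forall>R :: nat. k \<noteq> (\<lambda>_. 0) \<longrightarrow> \<not> resonant_datum a b k (real R) z"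
    by (simp add: AE_all_countable)
  then show ?thesis
  proof (rule AE_mp, intro AE_I2 impI)
    fix z :: "('m \<Rightarrow> 'n torus) \<times> ('m \<Rightarrow> real ^ 'n)"
    assume nonres: "\<forall>k. \<forall>R :: nat. k \<noteq> (\<lambda>_. 0) \<longrightarrow> \<not> resonant_datum a b k (real R) z"
    obtain x0 v0 where z: "z = (x0, v0)" by (cases z)
    have "(\<integral>\<^sup>+ s\<in>{0..}. ennreal (\<Sum>(i, j) | i \<noteq> j. \<phi> (x s i - x s j)) \<partial>lborel) = \<infinity>"
      if xv: "alignment_solution \<phi> x0 v0 x v" for x v
    proof (rule ccontr)
      assume fin: "(\<integral>\<^sup>+ s\<in>{0..}. ennreal (\<Sum>(i, j) | i \<noteq> j. \<phi> (x s i - x s j)) \<partial>lborel) \<noteq> \<infinity>"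
      obtain X where X: "lifted_solution X v" "\<And>t i. t \<ge> 0 \<Longrightarrow> to_torus (X t i) = x t i"
        using alignment_solution_lift[OF xv] by blast
      have init: "x 0 = x0" "v 0 = v0"
        using xv by (auto simp: alignment_solution_def)
      obtain I where I: "\<And>i. I i 0 = 0"
        "\<And>i t. 0 \<le> t \<Longrightarrow> (I i has_vector_derivative rate i (\<lambda>j. to_torus (X t j))) (at t within {0..})"
        using interaction_antiderivative[OF X(1)] by blast
      obtain B where B: "\<And>i t. 0 \<le> t \<Longrightarrow> I i t \<le> B"
        using finite_interaction_bounded[OF X(2) I fin lifted_solution_continuous(1)[OF X(1)]] by blast
      obtain R :: nat where R: "\<And>i. norm (v 0 i) \<le> real R"
      proof -
        obtain R :: nat where "(\<Sum>i\<in>UNIV. norm (v 0 i)) \<le> real R"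
          using real_arch_simple by blast
        moreover have "norm (v 0 i) \<le> (\<Sum>i\<in>UNIV. norm (v 0 i))" for i
          by (rule member_le_sum) auto
        ultimately show ?thesis using that order_trans by blast
      qed
      have vb: "norm (v t i) \<le> real R" if "0 \<le> t" for t i
        by (rule velocity_le_initial[OF X(1) R that])
      obtain va where va: "((\<lambda>t. v t a) \<longlongrightarrow> va) at_top"
        by (rule velocity_converges[OF X(1) vb I(2) B])
      obtain vb' where vb': "((\<lambda>t. v t b) \<longlongrightarrow> vb') at_top"
        by (rule velocity_converges[OF X(1) vb I(2) B])
      obtain k where k: "k \<noteq> (\<lambda>_. 0)" "resonant k (va - vb')"
        by (rule limit_velocities_resonant[OF X(1) vb I(2) B ab va vb'])
      have "z = (\<lambda>i. to_torus (X 0 i), v 0)"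
        by (simp add: z X(2) init)
      then have "resonant_datum a b k (real R) z"
        unfolding resonant_datum_def using X(1) R I B va vb' k(2) by blast
      then show False using nonres k(1) by blast
    qed
    then show "case z of (x0, v0) \<Rightarrow> \<forall>x v. alignment_solution \<phi> x0 v0 x v \<longrightarrow>
      (\<integral>\<^sup>+ s\<in>{0..}. ennreal (\<Sum>(i, j) | i \<noteq> j. \<phi> (x s i - x s j)) \<partial>lborel) = \<infinity>"
      unfolding z prod.case by blast
  qed
qed

end
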